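(* Let $\mathcal{R}:\mathcal{CP}_1\to\mathcal{DPV}$ be the Morley reconstruction, with local operators $\mathcal{R}_K$. Then, apart from the enforcement of clamped boundary conditions and the calculation of the load, the method with bilinear form $a(\mathcal{R}U,\mathcal{R}v)$ is equivalent to the Basic Plate Triangle method, in the following sense: for all $U,v\in\mathcal{CP}_1$ and every $K\in\mathcal{K}$, $$a_K(\mathcal{R}_KU,\mathcal{R}_Kv)=\hat a_K(U,v),$$ and consequently $$a(\mathcal{R}U,\mathcal{R}v)=\sum_{K\in\mathcal{K}}\hat a_K(U,v)+\sum_{E\in\mathcal{E}_C}a_E(\mathcal{R}U,\mathcal{R}v)\quad\text{for all }U,v\in\mathcal{CP}_1,$$ where $\hat a_K$ is the element bilinear form of the Basic Plate Triangle.
   Context: Notation: summation convention; a comma denotes differentiation; $(\cdot,\cdot)_\omega$ is the $L^2(\omega)$ inner product; $\mathcal{P}_k$ denotes polynomials of degree at most $k$. $\kappa_{ij}(v)=v_{,ij}$, $\sigma_{ij}(v)=\lambda\Delta v\,\delta_{ij}+\mu\kappa_{ij}(v)$, $i,j=1,2$, with constants $\lambda,\mu$ (plate Lamé parameters, $\mu>0$). For a unit normal $n$ and tangent $t=(n_2,-n_1)$: $v_{,n}=v_{,j}n_j$, $M_{nn}=\sigma_{ij}n_in_j$, $M_{nt}=\sigma_{ij}n_it_j$, $T=\sigma_{ij,j}n_i+M_{nt,t}$, with $M_{nt,t}$ the tangential derivative. $\mathcal{K}$ is a conforming triangulation of a plane domain $\Omega$ with mesh size $h$, whose boundary is split into clamped,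 simply supported and free parts $\Gamma_C,\Gamma_S,\Gamma_F$; $\mathcal{E}=\mathcal{E}_I\cup\mathcal{E}_C\cup\mathcal{E}_S\cup\mathcal{E}_F$ is the set of edges (interior, and on $\Gamma_C,\Gamma_S,\Gamma_F$). Each edge $E$ has a fixed unit normal $n_E$ (exterior on the boundary). For every boundary edge with endpoints $x_1,x_2$ belonging to the element with third node $x_3$, a ghost triangle with vertices $x_1,x_2,x_G=x_1+x_2-x_3$ is added outside $\Omega$; $\mathcal{K}_G$ is the set of ghost elements. $\mathcal{CP}_1$: continuous piecewise linear functions on $\mathcal{K}\cup\mathcal{K}_G$ vanishing on the edges in $\mathcal{E}_C\cup\mathcal{E}_S$. $\mathcal{DPV}$: functions that are in $\mathcal{P}_2(K)$ on each $K\in\mathcal{K}$, continuous at all nodes of $\mathcal{K}$, and zero at nodes of edges in $\mathcal{E}_C\cup\mathcal{E}_S$. With $v^\pm(x)=\lim_{\epsilon\to0^+}v(x\mp\epsilon n_E)$: on interior edges $\langle v\rangle=(v^++v^-)/2$, $[v]=v^+-v^-$; for functions defined only on $\mathcal{K}$, $\langle v\rangle=[v]=v^+$ on boundary edges. For $w\in\mathcal{CP}_1$, $\langle w_{,i}\rangle$ and $\langle w_{,n}\rangle$ on any edge denote the average over the two neighboring linear triangles (the ghost element being the second neighbor on a boundary edge). $P_0$ is the $L^2$ projection onto constants on each edge. Morley reconstruction: for $K\in\mathcal{K}$, $\mathcal{R}_Kv\in\mathcal{P}_2$ is defined by $\mathcal{R}_Kv=v$ at the three nodes of $K$ and $(\mathcal{R}_Kv)_{,n}=\langle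 v_{,n}\rangle$ at the three edge midpoints of $K$; $(\mathcal{R}v)|_K=(\mathcal{R}_Kv)|_K$. Bilinear forms ($\beta>0$ a parameter): $$a_K(v,w)=(\sigma_{ij}(v),\kappa_{ij}(w))_K,$$ $$a_E(v,w)=-(\langle M_{nn}(v)\rangle,[w_{,n}])_E-([v_{,n}],\langle M_{nn}(w)\rangle)_E+\beta(h^{-1}P_0[v_{,n}],P_0[w_{,n}])_E,$$ $$a(v,w)=\sum_{K\in\mathcal{K}}a_K(v,w)+\sum_{E\in\mathcal{E}\setminus(\mathcal{E}_S\cup\mathcal{E}_F)}a_E(v,w)+\sum_{E\in\mathcal{E}\setminus\mathcal{E}_F}\big((\langle T(v)\rangle,[w])_E+([v],\langle T(w)\rangle)_E\big).$$ Basic Plate Triangle element form: with $n$ the outward unit normal of $K$, $|K|$ the area of $K$, $h_E$ the length and $x_E$ the midpoint of the edge $E$, $$\hat a_K(U,v)=\frac{1}{|K|}\Big(\sum_{E\subset\partial K}h_E\big(\lambda\langle U_{,n}\rangle\delta_{ij}+\mu\langle U_{,i}\rangle n_j\big)\big|_{x_E}\Big)\Big(\sum_{E\subset\partial K}h_E\big(\langle v_{,i}\rangle n_j\big)\big|_{x_E}\Big)$$ (summed over $i,j=1,2$). The Basic Plate Triangle method reads: find $U\in\mathcal{CP}_1$ with $\sum_{K\in\mathcal{K}}\hat a_K(U,v)=(f,v)_\Omega$ for all $v\in\mathcal{CP}_1$; the reconstruction method reads: find $U\in\mathcal{CP}_1$ with $a(\mathcal{R}U,\mathcal{R}v)=(f,\mathcal{R}v)_\Omega$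 for all $v\in\mathcal{CP}_1$. *)

theory Defs
  imports "HOL-Analysis.Analysis"
begin

type_synonym point = "real ^ 2"

definition polys :: "nat \<Rightarrow> (point \<Rightarrow> real) set" where
  "polys k = {p. \<exists>c :: nat \<Rightarrow> nat \<Rightarrow> real.
     p = (\<lambda>x. \<Sum>(a, b) \<in> {(a, b). a + b \<le> k}. c a b * (x $ 1) ^ a * (x $ 2) ^ b)}"

definition dir_deriv :: "point \<Rightarrow> (point \<Rightarrow> real) \<Rightarrow> point \<Rightarrow> real" where
  "dir_deriv d v x = deriv (\<lambda>s. v (x + s *\<^sub>R d)) 0"

definition pd :: "2 \<Rightarrow> (point \<Rightarrow> real) \<Rightarrow> point \<Rightarrow> real" where
  "pd i v = dir_deriv (axis i 1) v"

definition normal_deriv :: "point \<Rightarrow> (point \<Rightarrow> real) \<Rightarrow> point \<Rightarrow> real" where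
  "normal_deriv n v x = (\<Sum>j\<in>UNIV. pd j v x * n $ j)"

definition kron :: "2 \<Rightarrow> 2 \<Rightarrow> real" where
  "kron i j = (if i = j then 1 else 0)"

definition curvature :: "(point \<Rightarrow> real) \<Rightarrow> 2 \<Rightarrow> 2 \<Rightarrow> point \<Rightarrow> real" where
  "curvature v i j = pd j (pd i v)"

definition laplacian :: "(point \<Rightarrow> real) \<Rightarrow> point \<Rightarrow> real" where
  "laplacian v x = (\<Sum>k\<in>UNIV. pd k (pd k v) x)"

definition stress :: "real \<Rightarrow> real \<Rightarrow> (point \<Rightarrow> real) \<Rightarrow> 2 \<Rightarrow> 2 \<Rightarrow> point \<Rightarrow> real" where
  "stress lam mu v i j x = lam * laplacian v x * kron i j + mu * curvature v i j x"

definition tangent :: "point \<Rightarrow> point" where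
  "tangent n = vector [n $ 2, - (n $ 1)]"

definition Mnn :: "real \<Rightarrow> real \<Rightarrow> point \<Rightarrow> (point \<Rightarrow> real) \<Rightarrow> point \<Rightarrow> real" where
  "Mnn lam mu n v x = (\<Sum>i\<in>UNIV. \<Sum>j\<in>UNIV. stress lam mu v i j x * n $ i * n $ j)"

definition Mnt :: "real \<Rightarrow> real \<Rightarrow> point \<Rightarrow> (point \<Rightarrow> real) \<Rightarrow> point \<Rightarrow> real" where
  "Mnt lam mu n v x = (\<Sum>i\<in>UNIV. \<Sum>j\<in>UNIV. stress lam mu v i j x * n $ i * tangent n $ j)"

definition Tforce :: "real \<Rightarrow> real \<Rightarrow> point \<Rightarrow> (point \<Rightarrow> real) \<Rightarrow> point \<Rightarrow> real" where
  "Tforce lam mu n v x =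
     (\<Sum>i\<in>UNIV. \<Sum>j\<in>UNIV. pd j (stress lam mu v i j) x * n $ i)
     + dir_deriv (tangent n) (Mnt lam mu n v) x"

definition edge_ends :: "point set \<Rightarrow> point \<times> point" where
  "edge_ends E = (SOME p. E = closed_segment (fst p) (snd p))"

definition edge_length :: "point set \<Rightarrow> real" where
  "edge_length E = dist (fst (edge_ends E)) (snd (edge_ends E))"

definition edge_midpoint :: "point set \<Rightarrow> point" where
  "edge_midpoint E = midpoint (fst (edge_ends E)) (snd (edge_ends E))"

definition elem_ip :: "point set \<Rightarrow> (point \<Rightarrow> real) \<Rightarrow> (point \<Rightarrow> real) \<Rightarrow> real" where
  "elem_ip K u w = (LINT x:K|lebesgue. u x * w x)"

text \<open>The inner product of \<open>L\<^sup>2(E)\<close> with respect to arc length.\<close>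

definition edge_ip :: "point set \<Rightarrow> (point \<Rightarrow> real) \<Rightarrow> (point \<Rightarrow> real) \<Rightarrow> real" where
  "edge_ip E u w =
     (let g = linepath (fst (edge_ends E)) (snd (edge_ends E))
      in edge_length E * (LINT s:{0..1}|lebesgue. u (g s) * w (g s)))"

definition P0 :: "point set \<Rightarrow> (point \<Rightarrow> real) \<Rightarrow> point \<Rightarrow> real" where
  "P0 E u = (\<lambda>_. THE c. \<forall>d. edge_ip E (\<lambda>x. u x - c) (\<lambda>_. d) = 0)"

record plate_mesh =
  region :: "point set"
  elems :: "point set set"
  GammaC :: "point set"
  GammaS :: "point set"
  GammaF :: "point set"
  enormal :: "point set \<Rightarrow> point"

definition edges :: "plate_mesh \<Rightarrow> point set set" where
  "edges M = {E. \<exists>K\<in>elems M. E edge_of K}"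

definition boundary_edges :: "plate_mesh \<Rightarrow> point set set" where
  "boundary_edges M = {E. \<exists>!K. K \<in> elems M \<and> E edge_of K}"

definition EC :: "plate_mesh \<Rightarrow> point set set" where
  "EC M = {E \<in> boundary_edges M. E \<subseteq> GammaC M}"

definition ES :: "plate_mesh \<Rightarrow> point set set" where
  "ES M = {E \<in> boundary_edges M. E \<subseteq> GammaS M}"

definition EF :: "plate_mesh \<Rightarrow> point set set" where
  "EF M = {E \<in> boundary_edges M. E \<subseteq> GammaF M}"

definition mesh_nodes :: "plate_mesh \<Rightarrow> point set" where
  "mesh_nodes M = {x. \<exists>K\<in>elems M. x extreme_point_of K}"

definition mesh_size :: "plate_mesh \<Rightarrow> real" where
  "mesh_size M = Max (diameter ` elems M)"

definition outer_normal :: "point set \<Rightarrow> point set \<Rightarrow> point" where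
  "outer_normal K E = (THE n. norm n = 1 \<and> (\<forall>x\<in>E. \<forall>y\<in>E. n \<bullet> (y - x) = 0)
                              \<and> (\<forall>x\<in>E. \<forall>y\<in>K. n \<bullet> (y - x) \<le> 0))"

text \<open>The library notion of a triangulation includes conformity: two elements meet in a common face.
  The requirement that the domain be the interior of the union of the elements excludes slits, so that the edges on the boundary
  are exactly those with a single neighbouring element. The three boundary parts may share end
  points of edges.\<close>

definition plate_triangulation :: "plate_mesh \<Rightarrow> bool" where
  "plate_triangulation M \<longleftrightarrow>
     elems M \<noteq> {} \<and> triangulation (elems M) \<and> (\<forall>K\<in>elems M. 2 simplex K) \<and>
     region M = interior (\<Union>(elems M)) \<and> connected (region M) \<and>
     frontier (region M) = GammaC M \<union> GammaS M \<union> GammaF M \<and>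
     finite (GammaC M \<inter> GammaS M) \<and> finite (GammaC M \<inter> GammaF M) \<and>
     finite (GammaS M \<inter> GammaF M) \<and>
     boundary_edges M = EC M \<union> ES M \<union> EF M \<and>
     (\<forall>E\<in>edges M. norm (enormal M E) = 1 \<and> (\<forall>x\<in>E. \<forall>y\<in>E. enormal M E \<bullet> (y - x) = 0)) \<and>
     (\<forall>E\<in>boundary_edges M. \<forall>K\<in>elems M. E edge_of K \<longrightarrow> enormal M E = outer_normal K E)"

definition boundary_elem :: "plate_mesh \<Rightarrow> point set \<Rightarrow> point set" where
  "boundary_elem M E = (THE K. K \<in> elems M \<and> E edge_of K)"

definition ghost :: "plate_mesh \<Rightarrow> point set \<Rightarrow> point set" where
  "ghost M E =
     (let x1 = fst (edge_ends E); x2 = snd (edge_ends E);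
          x3 = (THE x. x extreme_point_of boundary_elem M E \<and> x \<notin> E)
      in convex hull {x1, x2, x1 + x2 - x3})"

text \<open>Ghost elements of different boundary edges may overlap as point sets when the domain is not
  convex. A function on the extended mesh is therefore a pair: its restriction to the union of the
  elements, and for each boundary edge its restriction to the ghost element across that edge.
  Continuity of such a pair means continuity of the first part and matching across each boundary
  edge.\<close>

type_synonym ext_fun = "(point \<Rightarrow> real) \<times> (point set \<Rightarrow> point \<Rightarrow> real)"

definition CP1 :: "plate_mesh \<Rightarrow> ext_fun set" where
  "CP1 M = {(w, g).
     continuous_on (\<Union>(elems M)) w \<and>
     (\<forall>K\<in>elems M. \<exists>p\<in>polys 1. \<forall>x\<in>K. w x = p x) \<and>
     (\<forall>E\<in>boundary_edges M. (\<exists>p\<in>polys 1. \<forall>x\<in>ghost M E. g E x = p x) \<and> (\<forall>x\<in>E. g E x = w x)) \<and>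
     (\<forall>E\<in>EC M \<union> ES M. \<forall>x\<in>E. w x = 0)}"

text \<open>Elements of the following space may jump across edges; being polynomial on an element is
  therefore required in its interior only. Values on edges matter only through continuity at the nodes.\<close>

definition DPV :: "plate_mesh \<Rightarrow> (point \<Rightarrow> real) set" where
  "DPV M = {v.
     (\<forall>K\<in>elems M. \<exists>p\<in>polys 2. \<forall>x\<in>interior K. v x = p x) \<and>
     (\<forall>x\<in>mesh_nodes M. continuous (at x within \<Union>(elems M)) v) \<and>
     (\<forall>E\<in>EC M \<union> ES M. \<forall>x. x extreme_point_of E \<longrightarrow> v x = 0)}"

text \<open>The constant value on a triangle of a first derivative of a function that is affine there.\<close>

definition tri_pd :: "point set \<Rightarrow> 2 \<Rightarrow> (point \<Rightarrow> real) \<Rightarrow> real" where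
  "tri_pd K i w = (THE c. \<forall>x\<in>interior K. pd i w x = c)"

definition avg_pd :: "plate_mesh \<Rightarrow> point set \<Rightarrow> 2 \<Rightarrow> ext_fun \<Rightarrow> real" where
  "avg_pd M E i w =
     (if E \<in> boundary_edges M
      then (tri_pd (boundary_elem M E) i (fst w) + tri_pd (ghost M E) i (snd w E)) / 2
      else (\<Sum>K | K \<in> elems M \<and> E edge_of K. tri_pd K i (fst w)) / 2)"

definition avg_nd :: "plate_mesh \<Rightarrow> point set \<Rightarrow> point \<Rightarrow> ext_fun \<Rightarrow> real" where
  "avg_nd M E n w = (\<Sum>i\<in>UNIV. avg_pd M E i w * n $ i)"

definition morley_loc :: "plate_mesh \<Rightarrow> point set \<Rightarrow> ext_fun \<Rightarrow> point \<Rightarrow> real" where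
  "morley_loc M K v = (THE p. p \<in> polys 2 \<and>
     (\<forall>x. x extreme_point_of K \<longrightarrow> p x = fst v x) \<and>
     (\<forall>E. E edge_of K \<longrightarrow>
        normal_deriv (enormal M E) p (edge_midpoint E) = avg_nd M E (enormal M E) v))"

text \<open>On the edges one of the neighbouring elements is selected.\<close>

definition morley :: "plate_mesh \<Rightarrow> ext_fun \<Rightarrow> point \<Rightarrow> real" where
  "morley M v x = morley_loc M (SOME K. K \<in> elems M \<and> x \<in> K) v x"

definition trace_plus :: "point \<Rightarrow> (point \<Rightarrow> real) \<Rightarrow> point \<Rightarrow> real" where
  "trace_plus n u x = Lim (at_right 0) (\<lambda>e. u (x - e *\<^sub>R n))"

definition trace_minus :: "point \<Rightarrow> (point \<Rightarrow> real) \<Rightarrow> point \<Rightarrow> real" where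
  "trace_minus n u x = Lim (at_right 0) (\<lambda>e. u (x + e *\<^sub>R n))"

definition avg :: "plate_mesh \<Rightarrow> point set \<Rightarrow> (point \<Rightarrow> real) \<Rightarrow> point \<Rightarrow> real" where
  "avg M E u x =
     (if E \<in> boundary_edges M then trace_plus (enormal M E) u x
      else (trace_plus (enormal M E) u x + trace_minus (enormal M E) u x) / 2)"

definition jump :: "plate_mesh \<Rightarrow> point set \<Rightarrow> (point \<Rightarrow> real) \<Rightarrow> point \<Rightarrow> real" where
  "jump M E u x =
     (if E \<in> boundary_edges M then trace_plus (enormal M E) u x
      else trace_plus (enormal M E) u x - trace_minus (enormal M E) u x)"

definition aK :: "real \<Rightarrow> real \<Rightarrow> point set \<Rightarrow> (point \<Rightarrow> real) \<Rightarrow> (point \<Rightarrow> real) \<Rightarrow> real" where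
  "aK lam mu K v w = (\<Sum>i\<in>UNIV. \<Sum>j\<in>UNIV. elem_ip K (stress lam mu v i j) (curvature w i j))"

definition aE :: "plate_mesh \<Rightarrow> real \<Rightarrow> real \<Rightarrow> real \<Rightarrow> point set \<Rightarrow>
    (point \<Rightarrow> real) \<Rightarrow> (point \<Rightarrow> real) \<Rightarrow> real" where
  "aE M lam mu beta E v w =
     (let n = enormal M E in
      - edge_ip E (avg M E (Mnn lam mu n v)) (jump M E (normal_deriv n w))
      - edge_ip E (jump M E (normal_deriv n v)) (avg M E (Mnn lam mu n w))
      + beta * edge_ip E (\<lambda>x. inverse (mesh_size M) * P0 E (jump M E (normal_deriv n v)) x)
                         (P0 E (jump M E (normal_deriv n w))))"

definition aform :: "plate_mesh \<Rightarrow> real \<Rightarrow> real \<Rightarrow> real \<Rightarrow>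
    (point \<Rightarrow> real) \<Rightarrow> (point \<Rightarrow> real) \<Rightarrow> real" where
  "aform M lam mu beta v w =
     (\<Sum>K\<in>elems M. aK lam mu K v w)
     + (\<Sum>E\<in>edges M - (ES M \<union> EF M). aE M lam mu beta E v w)
     + (\<Sum>E\<in>edges M - EF M.
          edge_ip E (avg M E (Tforce lam mu (enormal M E) v)) (jump M E w)
          + edge_ip E (jump M E v) (avg M E (Tforce lam mu (enormal M E) w)))"

definition bpt_form :: "plate_mesh \<Rightarrow> real \<Rightarrow> real \<Rightarrow> point set \<Rightarrow> ext_fun \<Rightarrow> ext_fun \<Rightarrow> real" where
  "bpt_form M lam mu K U v =
     1 / measure lebesgue K *
     (\<Sum>i\<in>UNIV. \<Sum>j\<in>UNIV.
        (\<Sum>E | E edge_of K. edge_length E *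
           (lam * avg_nd M E (outer_normal K E) U * kron i j
            + mu * avg_pd M E i U * outer_normal K E $ j)) *
        (\<Sum>E | E edge_of K. edge_length E * (avg_pd M E i v * outer_normal K E $ j)))"

end

theory Submission
  imports Defs
begin

text \<open>On an element the Hessian of a quadratic \<open>p\<close> is constant, and the divergence theorem together with
  the midpoint rule gives \<open>|K| p\<^sub>,\<^sub>i\<^sub>j = \<Sum>\<^sub>E h\<^sub>E p\<^sub>,\<^sub>i(x\<^sub>E) n\<^sub>j\<close>. For the Morley reconstruction of \<open>v\<close> the whole gradient at
  \<open>x\<^sub>E\<close> is the averaged gradient of \<open>v\<close>: the normal components agree by construction, and the tangential
  ones because both are the difference quotient of the nodal values of \<open>v\<close>. This is the element identity.
  In the global form, \<open>T\<close> vanishes on quadratics. On an interior edge the moment \<open>M\<^sub>n\<^sub>n\<close> has a constant average,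
  and the jump of the normal derivative is affine and vanishes at the midpoint, hence has mean zero, so
  that only the clamped edges contribute.\<close>

section \<open>Quadratic polynomials in the plane\<close>

text \<open>The obstacle is that the objects are given by descriptions, limits and choices instead
  of formulas. \<open>morley_loc\<close> is a definite description, so it is opaque until the Morley
  interpolant is known to exist and to be unique. Uniqueness is the divergence identity read
  backwards: zero gradients at the three midpoints force a zero Hessian. The global reconstruction
  follows an arbitrary neighbour on edges. It is therefore compared with the local polynomials only
  in open interiors, where differential operators are local, and on edges through traces at points
  other than end points; this is enough because end points and element boundaries are null sets. The
  two elements at an interior edge are told apart by their outer normals: an edge has two unit
  normals, and no two elements share one. Clamped edges survive because the jump there is the
  one-sided trace, whose midpoint value is an average with the ghost element and can be
  nonzero.\<close>

text \<open>The halves make \<open>h11\<close>, \<open>h12\<close>, \<open>h22\<close> the Hessian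
  entries and \<open>b1\<close>, \<open>b2\<close> the gradient at the origin, so that
  \<open>pd\<close> merely shifts coefficients.\<close>

definition quad :: "real \<Rightarrow> real \<Rightarrow> real \<Rightarrow> real \<Rightarrow> real \<Rightarrow> real \<Rightarrow> point \<Rightarrow> real" where
  "quad c b1 b2 h11 h12 h22 x =
     c + b1 * x $ 1 + b2 * x $ 2 + h11 * (x $ 1)^2 / 2 + h12 * x $ 1 * x $ 2 + h22 * (x $ 2)^2 / 2"

lemma polys_1_iff: "p \<in> polys 1 \<longleftrightarrow> (\<exists>c b1 b2. p = quad c b1 b2 0 0 0)"
proof -
  have s: "{(a, b). a + b \<le> (1::nat)} = {(0,0), (1,0), (0,1)}" by auto
  show ?thesis
  proof
    assume "p \<in> polys 1"
    then obtain c where "p = (\<lambda>x. \<Sum>(a, b) \<in> {(a, b). a + b \<le> 1}. c a b * (x $ 1) ^ a * (x $ 2) ^ b)"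
      by (auto simp: polys_def)
    then have "p = quad (c 0 0) (c 1 0) (c 0 1) 0 0 0"
      unfolding s by (auto simp: quad_def fun_eq_iff)
    then show "\<exists>c b1 b2. p = quad c b1 b2 0 0 0" by blast
  next
    assume "\<exists>c b1 b2. p = quad c b1 b2 0 0 0"
    then obtain c b1 b2 where p: "p = quad c b1 b2 0 0 0" by blast
    define f :: "nat \<Rightarrow> nat \<Rightarrow> real" where
      "f i j = (if i = 0 then (if j = 0 then c else b2) else b1)" for i j
    have "p = (\<lambda>x. \<Sum>(a, b) \<in> {(a, b). a + b \<le> 1}. f a b * (x $ 1) ^ a * (x $ 2) ^ b)"
      unfolding s by (simp add: p quad_def fun_eq_iff f_def)
    then show "p \<in> polys 1"
      unfolding polys_def by blast
  qed
qed

lemma polys_2_iff: "p \<in> polys 2 \<longleftrightarrow> (\<exists>c b1 b2 h11 h12 h22. p = quad c b1 b2 h11 h12 h22)"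
proof -
  have s: "{(a, b). a + b \<le> (2::nat)} = {(0,0), (1,0), (0,1), (2,0), (1,1), (0,2)}" by auto
  show ?thesis
  proof
    assume "p \<in> polys 2"
    then obtain c where "p = (\<lambda>x. \<Sum>(a, b) \<in> {(a, b). a + b \<le> 2}. c a b * (x $ 1) ^ a * (x $ 2) ^ b)"
      by (auto simp: polys_def)
    then have "p = quad (c 0 0) (c 1 0) (c 0 1) (2 * c 2 0) (c 1 1) (2 * c 0 2)"
      unfolding s by (auto simp: quad_def fun_eq_iff)
    then show "\<exists>c b1 b2 h11 h12 h22. p = quad c b1 b2 h11 h12 h22" by blast
  next
    assume "\<exists>c b1 b2 h11 h12 h22. p = quad c b1 b2 h11 h12 h22"
    then obtain c b1 b2 h11 h12 h22 where p: "p = quad c b1 b2 h11 h12 h22" by blast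
    \<comment> \<open>Only the six index pairs in \<open>s\<close> are read. The halves undo the
      factors 2 between monomial coefficients and Hessian entries.\<close>
    define f :: "nat \<Rightarrow> nat \<Rightarrow> real" where
      "f i j = (if i = 0 then (if j = 0 then c else if j = 1 then b2 else h22 / 2)
                else if i = 1 then (if j = 0 then b1 else h12) else h11 / 2)" for i j
    have "p = (\<lambda>x. \<Sum>(a, b) \<in> {(a, b). a + b \<le> 2}. f a b * (x $ 1) ^ a * (x $ 2) ^ b)"
      unfolding s by (simp add: p quad_def fun_eq_iff f_def)
    then show "p \<in> polys 2"
      unfolding polys_def by blast
  qed
qed

lemma polys_1_subset_2: "p \<in> polys 1 \<Longrightarrow> p \<in> polys 2"
  unfolding polys_1_iff polys_2_iff by blast

lemma polys_2_add: "p \<in> polys 2 \<Longrightarrow> q \<in> polys 2 \<Longrightarrow> (\<lambda>x. p x + q x) \<in> polys 2"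
proof -
  assume "p \<in> polys 2" "q \<in> polys 2"
  then obtain c b1 b2 h11 h12 h22 c' b1' b2' h11' h12' h22' where
    "p = quad c b1 b2 h11 h12 h22" "q = quad c' b1' b2' h11' h12' h22'"
    by (auto simp: polys_2_iff)
  then have "(\<lambda>x. p x + q x) = quad (c+c') (b1+b1') (b2+b2') (h11+h11') (h12+h12') (h22+h22')"
    by (simp add: quad_def fun_eq_iff algebra_simps add_divide_distrib)
  then show ?thesis unfolding polys_2_iff by blast
qed

lemma polys_2_scale: "p \<in> polys 2 \<Longrightarrow> (\<lambda>x. k * p x) \<in> polys 2"
proof -
  assume "p \<in> polys 2"
  then obtain c b1 b2 h11 h12 h22 where "p = quad c b1 b2 h11 h12 h22"
    by (auto simp: polys_2_iff)
  then have "(\<lambda>x. k * p x) = quad (k*c) (k*b1) (k*b2) (k*h11) (k*h12) (k*h22)"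
    by (simp add: quad_def fun_eq_iff algebra_simps)
  then show ?thesis unfolding polys_2_iff by blast
qed

lemma polys_2_diff: "p \<in> polys 2 \<Longrightarrow> q \<in> polys 2 \<Longrightarrow> (\<lambda>x. p x - q x) \<in> polys 2"
  using polys_2_add[of p "\<lambda>x. (-1) * q x"] polys_2_scale[of q "-1"] by simp

lemma polys_1_mult: "p \<in> polys 1 \<Longrightarrow> q \<in> polys 1 \<Longrightarrow> (\<lambda>x. p x * q x) \<in> polys 2"
proof -
  assume "p \<in> polys 1" "q \<in> polys 1"
  then obtain c b1 b2 c' b1' b2' where
    "p = quad c b1 b2 0 0 0" "q = quad c' b1' b2' 0 0 0"
    unfolding polys_1_iff by blast
  then have "(\<lambda>x. p x * q x) = quad (c*c') (c*b1'+b1*c') (c*b2'+b2*c') (2*b1*b1') (b1*b2'+b2*b1') (2*b2*b2')"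
    by (simp add: quad_def fun_eq_iff field_simps power2_eq_square)
  then show ?thesis unfolding polys_2_iff by blast
qed

lemma polys_1_affine: "(\<lambda>x::point. c + k \<bullet> x) \<in> polys 1"
  unfolding polys_1_iff
  by (intro exI[of _ c] exI[of _ "k $ 1"] exI[of _ "k $ 2"])
     (simp add: quad_def fun_eq_iff inner_vec_def sum_2)

lemma polys_2_continuous: "p \<in> polys 2 \<Longrightarrow> continuous_on S p"
  unfolding polys_2_iff quad_def[abs_def] by (auto intro!: continuous_intros)

lemma dir_deriv_quad:
  "dir_deriv d (quad c b1 b2 h11 h12 h22) x =
     (b1 + h11 * x $ 1 + h12 * x $ 2) * d $ 1 + (b2 + h12 * x $ 1 + h22 * x $ 2) * d $ 2"
  unfolding dir_deriv_def
  by (rule DERIV_imp_deriv)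
     (auto simp: quad_def[abs_def] power2_eq_square algebra_simps intro!: derivative_eq_intros)

lemma axis_2_nth: "axis (1::2) (1::real) $ 1 = 1" "axis (1::2) (1::real) $ 2 = 0"
  "axis (2::2) (1::real) $ 1 = 0" "axis (2::2) (1::real) $ 2 = 1"
  by (simp_all add: axis_def)

lemma pd_quad:
  "pd 1 (quad c b1 b2 h11 h12 h22) = quad b1 h11 h12 0 0 0"
  "pd 2 (quad c b1 b2 h11 h12 h22) = quad b2 h12 h22 0 0 0"
  by (auto simp: pd_def dir_deriv_quad axis_2_nth fun_eq_iff quad_def)

lemma pd_polys_2: "p \<in> polys 2 \<Longrightarrow> pd i p \<in> polys 1"
  using exhaust_2[of i] unfolding polys_2_iff polys_1_iff by (metis pd_quad)

text \<open>The origin is an arbitrary choice: on \<open>polys 2\<close> the second derivatives are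
  the same everywhere.\<close>

definition hess :: "(point \<Rightarrow> real) \<Rightarrow> 2 \<Rightarrow> 2 \<Rightarrow> real" where
  "hess p i j = curvature p i j 0"

lemma curvature_polys_2: "p \<in> polys 2 \<Longrightarrow> curvature p i j = (\<lambda>_. hess p i j)"
  using exhaust_2[of i] exhaust_2[of j]
  by (auto simp: hess_def curvature_def polys_2_iff pd_quad) (auto simp: quad_def fun_eq_iff)

lemma pd_polys_2_diff:
  assumes "p \<in> polys 2"
  shows "pd i p y - pd i p x = (\<Sum>j\<in>UNIV. hess p i j * (y - x) $ j)"
  using exhaust_2[of i] assms
  by (auto simp: hess_def curvature_def polys_2_iff pd_quad sum_2)
     (auto simp: quad_def fun_eq_iff algebra_simps)

text \<open>The gradient of an affine function is constant, so it may be taken at any point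
  \<open>z\<close>.\<close>

lemma polys_1_diff:
  assumes "p \<in> polys 1"
  shows "p y - p x = (\<Sum>i\<in>UNIV. pd i p z * (y - x) $ i)"
  using assms unfolding polys_1_iff
  by (auto simp: pd_quad sum_2) (auto simp: quad_def algebra_simps)

text \<open>Along the segment the derivative is affine in the parameter, so its mean is its value at
  the midpoint. This is how nodal values determine the tangential derivative at an edge
  midpoint.\<close>

lemma polys_2_midpoint_diff:
  assumes "p \<in> polys 2"
  shows "p y - p x = (\<Sum>i\<in>UNIV. pd i p (midpoint x y) * (y - x) $ i)"
  using assms
  by (auto simp: polys_2_iff pd_quad sum_2)
     (auto simp: quad_def midpoint_def field_simps power2_eq_square)

lemma pd_diff_polys_2:
  assumes "p \<in> polys 2" "q \<in> polys 2"
  shows "pd i (\<lambda>x. p x - q x) x = pd i p x - pd i q x"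
proof -
  obtain c b1 b2 h11 h12 h22 c' b1' b2' h11' h12' h22' where
    p: "p = quad c b1 b2 h11 h12 h22" "q = quad c' b1' b2' h11' h12' h22'"
    using assms by (auto simp: polys_2_iff)
  then have "(\<lambda>x. p x - q x) = quad (c-c') (b1-b1') (b2-b2') (h11-h11') (h12-h12') (h22-h22')"
    by (simp add: quad_def fun_eq_iff algebra_simps diff_divide_distrib)
  then show ?thesis
    using p exhaust_2[of i] by (auto simp: pd_quad) (auto simp: quad_def algebra_simps)
qed

lemma pd_add_polys_2:
  assumes "p \<in> polys 2" "q \<in> polys 2"
  shows "pd i (\<lambda>x. p x + q x) x = pd i p x + pd i q x"
proof -
  obtain c b1 b2 h11 h12 h22 c' b1' b2' h11' h12' h22' where
    p: "p = quad c b1 b2 h11 h12 h22" "q = quad c' b1' b2' h11' h12' h22'"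
    using assms by (auto simp: polys_2_iff)
  then have "(\<lambda>x. p x + q x) = quad (c+c') (b1+b1') (b2+b2') (h11+h11') (h12+h12') (h22+h22')"
    by (simp add: quad_def fun_eq_iff algebra_simps add_divide_distrib)
  then show ?thesis
    using p exhaust_2[of i] by (auto simp: pd_quad) (auto simp: quad_def algebra_simps)
qed

lemma pd_scale_polys_2:
  assumes "p \<in> polys 2"
  shows "pd i (\<lambda>x. k * p x) x = k * pd i p x"
proof -
  obtain c b1 b2 h11 h12 h22 where p: "p = quad c b1 b2 h11 h12 h22"
    using assms by (auto simp: polys_2_iff)
  then have "(\<lambda>x. k * p x) = quad (k*c) (k*b1) (k*b2) (k*h11) (k*h12) (k*h22)"
    by (simp add: quad_def fun_eq_iff algebra_simps)
  then show ?thesis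
    using p exhaust_2[of i] by (auto simp: pd_quad) (auto simp: quad_def algebra_simps)
qed

lemma pd_affine_mult:
  "pd i (\<lambda>x::point. (c + k \<bullet> x) * (d + l \<bullet> x)) x = k $ i * (d + l \<bullet> x) + (c + k \<bullet> x) * l $ i"
proof -
  have "(\<lambda>x::point. (c + k \<bullet> x) * (d + l \<bullet> x)) =
    quad (c*d) (c*l$1+k$1*d) (c*l$2+k$2*d) (2*k$1*l$1) (k$1*l$2+k$2*l$1) (2*k$2*l$2)"
    by (simp add: quad_def fun_eq_iff inner_vec_def sum_2 field_simps power2_eq_square)
  then show ?thesis using exhaust_2[of i]
    by (auto simp: pd_quad) (auto simp: quad_def inner_vec_def sum_2 algebra_simps)
qed

subsection \<open>Locality of the differential operators\<close>

text \<open>The derivative at parameter 0 depends only on the germ there, and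
  \<open>x + s *\<^sub>R d\<close> stays in \<open>S\<close> for small \<open>s\<close>.\<close>

lemma dir_deriv_cong_open:
  assumes "open S" "x \<in> S" "\<And>y. y \<in> S \<Longrightarrow> u y = w y"
  shows "dir_deriv d u x = dir_deriv d w x"
proof -
  have "((\<lambda>s::real. x + s *\<^sub>R d) \<longlongrightarrow> x + 0 *\<^sub>R d) (nhds 0)"
    by (intro tendsto_intros filterlim_ident)
  then have "\<forall>\<^sub>F s in nhds 0. x + s *\<^sub>R d \<in> S"
    using assms(1,2) by (simp add: topological_tendstoD)
  then have "\<forall>\<^sub>F s in nhds 0. u (x + s *\<^sub>R d) = w (x + s *\<^sub>R d)"
    by eventually_elim (use assms(3) in auto)
  then show ?thesis
    unfolding dir_deriv_def by (rule deriv_cong_ev) simp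
qed

context
  fixes S :: "point set" and u w :: "point \<Rightarrow> real"
  assumes S: "open S" and eq: "\<And>y. y \<in> S \<Longrightarrow> u y = w y"
begin

lemma pd_cong_open: "x \<in> S \<Longrightarrow> pd i u x = pd i w x"
  unfolding pd_def by (rule dir_deriv_cong_open[OF S]) (auto intro: eq)

text \<open>Locality passes to higher order because the inner derivatives agree on all of
  \<open>S\<close>, not just at \<open>x\<close>.\<close>

lemma pd_pd_cong_open: "x \<in> S \<Longrightarrow> pd j (pd i u) x = pd j (pd i w) x"
  unfolding pd_def[of j] by (rule dir_deriv_cong_open[OF S]) (auto intro: pd_cong_open)

lemma normal_deriv_cong_open: "x \<in> S \<Longrightarrow> normal_deriv n u x = normal_deriv n w x"
  by (simp add: normal_deriv_def pd_cong_open)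

lemma stress_cong_open: "x \<in> S \<Longrightarrow> stress lam mu u i j x = stress lam mu w i j x"
  by (simp add: stress_def laplacian_def curvature_def pd_pd_cong_open)

lemma Mnn_cong_open: "x \<in> S \<Longrightarrow> Mnn lam mu n u x = Mnn lam mu n w x"
  by (simp add: Mnn_def stress_cong_open)

lemma Mnt_cong_open: "x \<in> S \<Longrightarrow> Mnt lam mu n u x = Mnt lam mu n w x"
  by (simp add: Mnt_def stress_cong_open)

lemma Tforce_cong_open:
  assumes "x \<in> S"
  shows "Tforce lam mu n u x = Tforce lam mu n w x"
proof -
  have "pd j (stress lam mu u i j) x = pd j (stress lam mu w i j) x" for i j
    unfolding pd_def by (rule dir_deriv_cong_open[OF S assms]) (auto intro: stress_cong_open)
  moreover have "dir_deriv (tangent n) (Mnt lam mu n u) x = dir_deriv (tangent n) (Mnt lam mu n w) x"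
    by (rule dir_deriv_cong_open[OF S assms]) (auto intro: Mnt_cong_open)
  ultimately show ?thesis by (simp add: Tforce_def)
qed

end

lemma dir_deriv_const: "dir_deriv d (\<lambda>_. c) x = 0"
  by (simp add: dir_deriv_def)

section \<open>Stress, moment and force of a quadratic\<close>

definition stress_const :: "real \<Rightarrow> real \<Rightarrow> (point \<Rightarrow> real) \<Rightarrow> 2 \<Rightarrow> 2 \<Rightarrow> real" where
  "stress_const lam mu p i j = lam * (\<Sum>k\<in>UNIV. hess p k k) * kron i j + mu * hess p i j"

lemma stress_polys_2: "p \<in> polys 2 \<Longrightarrow> stress lam mu p i j = (\<lambda>_. stress_const lam mu p i j)"
  using curvature_polys_2[of p]
  by (simp add: fun_eq_iff stress_def stress_const_def laplacian_def curvature_def)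

lemma Mnn_polys_2:
  "p \<in> polys 2 \<Longrightarrow> Mnn lam mu n p = (\<lambda>_. \<Sum>i\<in>UNIV. \<Sum>j\<in>UNIV. stress_const lam mu p i j * n $ i * n $ j)"
  by (simp add: fun_eq_iff Mnn_def stress_polys_2)

text \<open>Stress and twisting moment of a quadratic are constant, and \<open>Tforce\<close>
  differentiates each of them once more.\<close>

lemma Tforce_polys_2: "p \<in> polys 2 \<Longrightarrow> Tforce lam mu n p = (\<lambda>_. 0)"
proof -
  assume p: "p \<in> polys 2"
  have "Mnt lam mu n p = (\<lambda>_. \<Sum>i\<in>UNIV. \<Sum>j\<in>UNIV. stress_const lam mu p i j * n $ i * tangent n $ j)"
    by (simp add: fun_eq_iff Mnt_def stress_polys_2 p)
  then have "dir_deriv (tangent n) (Mnt lam mu n p) x = 0" for x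
    by (simp add: dir_deriv_const)
  then show ?thesis
    by (simp add: fun_eq_iff Tforce_def pd_def stress_polys_2 p dir_deriv_const)
qed

section \<open>Triangles\<close>

text \<open>Twice the signed area; with one vertex replaced by \<open>x\<close> it is an
  unnormalized barycentric coordinate of \<open>x\<close>.\<close>

definition area2 :: "point \<Rightarrow> point \<Rightarrow> point \<Rightarrow> real" where
  "area2 a b c = (b $ 1 - a $ 1) * (c $ 2 - a $ 2) - (b $ 2 - a $ 2) * (c $ 1 - a $ 1)"

definition onormal :: "point \<Rightarrow> point \<Rightarrow> point" where
  "onormal a b = (1 / dist a b) *\<^sub>R tangent (b - a)"

text \<open>Positive \<open>area2\<close> means counterclockwise order. Then
  \<open>onormal a b\<close>, a clockwise quarter turn of \<open>b - a\<close> scaled to length 1,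
  points outwards, and a cyclic rotation of the vertices carries every statement about the edge
  \<open>ab\<close> to the other two.\<close>

definition tri :: "point set \<Rightarrow> point \<Rightarrow> point \<Rightarrow> point \<Rightarrow> bool" where
  "tri K a b c \<longleftrightarrow> K = convex hull {a, b, c} \<and> 0 < area2 a b c"

lemma area2_rotate: "area2 a b c = area2 b c a"
  by (simp add: area2_def algebra_simps)

lemma area2_swap: "area2 b a c = - area2 a b c"
  by (simp add: area2_def algebra_simps)

lemma area2_same: "area2 a b b = 0"
  by (simp add: area2_def)

lemma tri_rotate: "tri K a b c \<Longrightarrow> tri K b c a"
  using area2_rotate[of a b c] by (simp add: tri_def insert_commute)

lemma point_eq_iff: "(x::point) = y \<longleftrightarrow> x $ 1 = y $ 1 \<and> x $ 2 = y $ 2"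
  by (auto simp: vec_eq_iff forall_2)

lemma collinear_iff_area2: "collinear {a, b, c} \<longleftrightarrow> area2 a b c = 0"
proof
  assume "collinear {a, b, c}"
  then consider "a = c" | u where "b = u *\<^sub>R a + (1 - u) *\<^sub>R c"
    by (auto simp: collinear_3_expand)
  then show "area2 a b c = 0"
  proof cases
    case (2 u)
    show ?thesis unfolding 2 by (simp add: area2_def algebra_simps)
  qed (simp add: area2_def)
next
  assume 0: "area2 a b c = 0"
  show "collinear {a, b, c}"
  proof (cases "a = c")
    case False
    define d where "d = (c $ 1 - a $ 1)^2 + (c $ 2 - a $ 2)^2"
    have d: "d \<noteq> 0"
      using False by (auto simp: d_def point_eq_iff sum_power2_eq_zero_iff)
    \<comment> \<open>\<open>1 - u\<close> is the coefficient of the orthogonal projection of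
      \<open>b - a\<close> onto \<open>c - a\<close>; zero area means that \<open>b\<close> is its
      own projection onto the line through \<open>a\<close> and \<open>c\<close>.\<close>
    define u where "u = 1 - ((b $ 1 - a $ 1) * (c $ 1 - a $ 1) + (b $ 2 - a $ 2) * (c $ 2 - a $ 2)) / d"
    have "d * b $ 1 = d * (u * a $ 1 + (1 - u) * c $ 1)"
      using 0 d unfolding u_def by (simp add: field_simps) (simp add: area2_def d_def, algebra)
    moreover have "d * b $ 2 = d * (u * a $ 2 + (1 - u) * c $ 2)"
      using 0 d unfolding u_def by (simp add: field_simps) (simp add: area2_def d_def, algebra)
    ultimately have "b = u *\<^sub>R a + (1 - u) *\<^sub>R c"
      using d by (simp add: point_eq_iff)
    then show ?thesis
      by (auto simp: collinear_3_expand)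
  qed (simp add: collinear_3_expand)
qed

text \<open>Exchanging two vertices flips the sign of \<open>area2\<close>, so a positive order
  always exists.\<close>

lemma simplex_2_tri:
  fixes K :: "point set"
  assumes "2 simplex K"
  obtains a b c where "tri K a b c"
proof -
  obtain C where C: "\<not> affine_dependent C" "int (card C) = 2 + 1" "K = convex hull C"
    using assms unfolding simplex_def by blast
  then have "card C = 3" by simp
  then obtain a b c where abc: "C = {a, b, c}" "a \<noteq> b" "b \<noteq> c" "a \<noteq> c"
    by (auto simp: card_3_iff)
  then have "area2 a b c \<noteq> 0"
    using C(1) by (auto simp: collinear_3_eq_affine_dependent simp flip: collinear_iff_area2)
  moreover have "convex hull {b, a, c} = convex hull {a, b, c}" by (simp add: insert_commute)
  ultimately have "tri K a b c \<or> tri K b a c"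
    using C(3) abc(1) by (auto simp: tri_def area2_swap[of b a c])
  with that show thesis by blast
qed

lemma norm_onormal: "a \<noteq> b \<Longrightarrow> norm (onormal a b) = 1"
proof -
  assume "a \<noteq> b"
  have "norm (tangent (b - a)) = dist a b"
    by (simp add: norm_vec_def L2_set_def sum_2 tangent_def dist_vec_def dist_real_def
        dist_norm power2_commute algebra_simps)
  then show ?thesis using \<open>a \<noteq> b\<close> by (simp add: onormal_def)
qed

text \<open>Area divided by base: up to sign this is the height of \<open>x\<close> over the line
  through \<open>a\<close> and \<open>b\<close>.\<close>

lemma inner_onormal: "onormal a b \<bullet> (x - a) = - area2 a b x / dist a b"
  by (simp add: onormal_def inner_vec_def sum_2 tangent_def area2_def algebra_simps
      add_divide_distrib diff_divide_distrib)

lemma unit_perp_cases: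
  assumes "a \<noteq> b" "norm n = 1" "n \<bullet> (b - a) = 0"
  shows "n = onormal a b \<or> n = - onormal a b"
proof -
  define d where "d = b - a"
  \<comment> \<open>\<open>k\<close> is the inner product of \<open>n\<close> with
    \<open>tangent d\<close>. Lagrange's identity, with \<open>n\<close> a unit vector orthogonal to
    \<open>d\<close>, gives \<open>k^2 = (norm d)^2\<close>, which leaves only the choice of a
    sign.\<close>
  define k where "k = n $ 1 * d $ 2 - n $ 2 * d $ 1"
  have dist: "dist a b = norm d" by (simp add: d_def dist_norm norm_minus_commute)
  have d2: "(norm d)^2 = (d $ 1)^2 + (d $ 2)^2" and n2: "(n $ 1)^2 + (n $ 2)^2 = 1"
    using assms(2) by (simp_all add: norm_vec_def L2_set_def sum_2)
  have perp: "n $ 1 * d $ 1 + n $ 2 * d $ 2 = 0"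
    using assms(3) by (simp add: d_def inner_vec_def sum_2)
  have pos: "0 < norm d" using assms(1) by (simp add: d_def)
  have "k^2 = (norm d)^2"
    unfolding d2 k_def using perp n2 by algebra
  then have k: "k = norm d \<or> k = - norm d" by (simp add: power2_eq_iff)
  have n: "(norm d)^2 * n $ 1 = k * d $ 2" "(norm d)^2 * n $ 2 = - (k * d $ 1)"
    unfolding d2 k_def using perp by algebra+
  from k have "norm d * n $ 1 = d $ 2 \<and> norm d * n $ 2 = - d $ 1 \<or>
               norm d * n $ 1 = - d $ 2 \<and> norm d * n $ 2 = d $ 1"
  proof
    assume "k = norm d"
    with n have "norm d * (norm d * n $ 1) = norm d * d $ 2" "norm d * (norm d * n $ 2) = norm d * (- d $ 1)"
      by (simp_all add: power2_eq_square)
    with pos show ?thesis by (simp only: mult_cancel_left) auto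
  next
    assume "k = - norm d"
    with n have "norm d * (norm d * n $ 1) = norm d * (- d $ 2)" "norm d * (norm d * n $ 2) = norm d * d $ 1"
      by (simp_all add: power2_eq_square)
    with pos show ?thesis by (simp only: mult_cancel_left) auto
  qed
  then have "n $ 1 = d $ 2 / norm d \<and> n $ 2 = - (d $ 1 / norm d) \<or>
             n $ 1 = - (d $ 2 / norm d) \<and> n $ 2 = d $ 1 / norm d"
    using pos by (auto simp: nonzero_eq_divide_eq minus_divide_left mult.commute simp del: minus_divide_left[symmetric])
  then show ?thesis
    unfolding onormal_def dist d_def[symmetric]
    by (auto simp: point_eq_iff tangent_def)
qed

context
  fixes K a b c assumes t: "tri K a b c"
begin

lemma tri_distinct: "a \<noteq> b" "b \<noteq> c" "c \<noteq> a"
  using t by (auto simp: tri_def area2_def)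

lemma tri_not_collinear: "\<not> collinear {a, b, c}"
  using t by (simp add: collinear_iff_area2 tri_def)

lemma tri_independent: "\<not> affine_dependent {a, b, c}"
  using tri_not_collinear by (auto simp: collinear_3_eq_affine_dependent)

lemma tri_extreme_point: "x extreme_point_of K \<longleftrightarrow> x \<in> {a, b, c}"
  using t extreme_point_of_convex_hull_affine_independent[OF tri_independent]
  by (simp add: tri_def)

text \<open>The faces of a simplex are the hulls of subsets of its vertices, and dimension 1 selects
  the subsets with two elements.\<close>

lemma tri_edge: "E edge_of K \<longleftrightarrow> E \<in> {closed_segment a b, closed_segment b c, closed_segment c a}"
proof -
  have face: "E face_of K \<longleftrightarrow> (\<exists>s. s \<subseteq> {a, b, c} \<and> E = convex hull s)" for E
    using t face_of_convex_hull_affine_independent[OF tri_independent] by (simp add: tri_def)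
  have dim: "aff_dim (convex hull s) = int (card s) - 1" if "s \<subseteq> {a, b, c}" for s
    using aff_dim_affine_independent[OF affine_independent_subset[OF tri_independent that]]
    by (simp add: aff_dim_convex_hull)
  have card: "card s = 2 \<longleftrightarrow> s \<in> {{a, b}, {b, c}, {c, a}}" if "s \<subseteq> {a, b, c}" for s
    using that tri_distinct by (auto simp: card_2_iff)
  show ?thesis
  proof
    assume "E edge_of K"
    then obtain s where s: "s \<subseteq> {a, b, c}" "E = convex hull s" "aff_dim E = 1"
      by (auto simp: edge_of_def face)
    then have "card s = 2" using dim by fastforce
    with s card show "E \<in> {closed_segment a b, closed_segment b c, closed_segment c a}"
      by (auto simp: segment_convex_hull)
  next
    assume "E \<in> {closed_segment a b, closed_segment b c, closed_segment c a}"
    then obtain s where s: "s \<in> {{a, b}, {b, c}, {c, a}}" "E = convex hull s"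
      by (auto simp: segment_convex_hull)
    then have "s \<subseteq> {a, b, c}" by auto
    with s dim card show "E edge_of K"
      by (auto simp: edge_of_def face)
  qed
qed

lemma tri_sum_edges:
  "(\<Sum>E | E edge_of K. f E) = f (closed_segment a b) + f (closed_segment b c) + (f (closed_segment c a) :: real)"
proof -
  have "{E. E edge_of K} = {closed_segment a b, closed_segment b c, closed_segment c a}"
    by (auto simp: tri_edge)
  then show ?thesis
    using tri_distinct by (auto simp: doubleton_eq_iff)
qed

text \<open>Divided by \<open>area2 a b c\<close>, the three areas are the barycentric coordinates
  of \<open>x\<close>, and the interior is where all of them are positive.\<close>

lemma tri_interiorI:
  assumes "0 < area2 x b c" "0 < area2 a x c" "0 < area2 a b x"
  shows "x \<in> interior K"
proof -
  have pos: "0 < area2 a b c" and K: "K = convex hull {a, b, c}"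
    using t by (auto simp: tri_def)
  have sum: "area2 x b c + area2 a x c + area2 a b x = area2 a b c"
    by (simp add: area2_def algebra_simps)
  define u v w where "u = area2 x b c / area2 a b c" "v = area2 a x c / area2 a b c"
    "w = area2 a b x / area2 a b c"
  have "u *\<^sub>R a + v *\<^sub>R b + w *\<^sub>R c = x"
    using pos by (simp add: point_eq_iff u_v_w_def field_simps) (simp add: area2_def, algebra)
  moreover have "u + v + w = 1"
    using pos sum by (simp add: u_v_w_def flip: add_divide_distrib)
  moreover have "0 < u" "0 < v" "0 < w"
    using assms pos by (auto simp: u_v_w_def)
  ultimately show ?thesis
    unfolding K using interior_convex_hull_3_minimal[OF tri_not_collinear] by auto
qed

lemma tri_measure: "measure lebesgue K = area2 a b c / 2"
proof -
  have "compact K" using t by (simp add: tri_def finite_imp_compact_convex_hull)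
  then have "measure lebesgue K = measure lborel K"
    by (intro measure_completion) (auto dest: compact_imp_closed)
  also have "\<dots> = area2 a b c / 2"
    using t by (simp add: tri_def content_triangle) (simp add: area2_def abs_if algebra_simps)
  finally show ?thesis .
qed

lemma tri_below:
  assumes "x \<in> closed_segment a b" "y \<in> K"
  shows "onormal a b \<bullet> (y - x) \<le> 0"
proof -
  obtain s where s: "x = (1 - s) *\<^sub>R a + s *\<^sub>R b"
    using assms(1) by (auto simp: in_segment)
  \<comment> \<open>Only the \<open>c - a\<close> component has a part normal to the edge, and its
    coefficient \<open>v\<close> is a barycentric coordinate.\<close>
  obtain u v where y: "y = a + u *\<^sub>R (b - a) + v *\<^sub>R (c - a)" "0 \<le> v"
    using assms(2) t by (auto simp: tri_def convex_hull_3_alt)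
  have "y - x = (u - s) *\<^sub>R (b - a) + v *\<^sub>R (c - a)"
    unfolding s y by (simp add: algebra_simps)
  then have "onormal a b \<bullet> (y - x) = - (v * area2 a b c / dist a b)"
    using inner_onormal[of a b b] inner_onormal[of a b c] area2_same
    by (simp add: inner_right_distrib inner_scaleR_right)
  moreover have "0 \<le> v * area2 a b c / dist a b"
    using y(2) t by (simp add: tri_def)
  ultimately show ?thesis by simp
qed

lemma tri_outer_normal: "outer_normal K (closed_segment a b) = onormal a b"
  unfolding outer_normal_def
proof (rule the_equality)
  have perp: "onormal a b \<bullet> (y - x) = 0" if xy: "x \<in> closed_segment a b" "y \<in> closed_segment a b" for x y
  proof -
    obtain s u where s: "x = (1 - s) *\<^sub>R a + s *\<^sub>R b" "y = (1 - u) *\<^sub>R a + u *\<^sub>R b"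
      using xy unfolding in_segment by blast
    have "y - x = (u - s) *\<^sub>R (b - a)" unfolding s by (simp add: algebra_simps)
    then show ?thesis using inner_onormal[of a b b] by (simp add: area2_def)
  qed
  show "norm (onormal a b) = 1 \<and> (\<forall>x\<in>closed_segment a b. \<forall>y\<in>closed_segment a b. onormal a b \<bullet> (y - x) = 0)
    \<and> (\<forall>x\<in>closed_segment a b. \<forall>y\<in>K. onormal a b \<bullet> (y - x) \<le> 0)"
    using norm_onormal tri_distinct perp tri_below by blast
next
  fix n assume n: "norm n = 1 \<and> (\<forall>x\<in>closed_segment a b. \<forall>y\<in>closed_segment a b. n \<bullet> (y - x) = 0)
    \<and> (\<forall>x\<in>closed_segment a b. \<forall>y\<in>K. n \<bullet> (y - x) \<le> 0)"
  \<comment> \<open>Of the two unit normals of the edge, the third vertex excludes the inward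
    one.\<close>
  have "c \<in> K" using t by (simp add: tri_def hull_inc)
  then have "n \<bullet> (c - a) \<le> 0" using n by simp
  moreover have "onormal a b \<bullet> (c - a) < 0"
    using t tri_distinct by (simp add: inner_onormal tri_def)
  ultimately have "n \<noteq> - onormal a b" by auto
  then show "n = onormal a b"
    using unit_perp_cases[of a b n] n tri_distinct by auto
qed

text \<open>The coordinates of \<open>a\<close> and \<open>b\<close> are positive at
  \<open>x\<close> and stay so by continuity; that of \<open>c\<close> vanishes at \<open>x\<close>
  and grows linearly in \<open>e\<close>. Thus limits against the outer normal see only the interior
  of \<open>K\<close>.\<close>

lemma tri_push:
  assumes "x \<in> open_segment a b"
  shows "\<forall>\<^sub>F e in at_right 0. x - e *\<^sub>R onormal a b \<in> interior K"
proof -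
  obtain s where s: "0 < s" "s < 1" "x = (1 - s) *\<^sub>R a + s *\<^sub>R b"
    using assms by (auto simp: in_segment)
  let ?y = "\<lambda>e. x - e *\<^sub>R onormal a b"
  have y0: "?y 0 = x" by simp
  have pos: "0 < area2 a b c" using t by (simp add: tri_def)
  have tend: "((\<lambda>e. area2 (?y e) b c) \<longlongrightarrow> area2 (?y 0) b c) (at_right 0)"
       "((\<lambda>e. area2 a (?y e) c) \<longlongrightarrow> area2 a (?y 0) c) (at_right 0)"
    unfolding area2_def by (intro tendsto_intros)+
  have v: "area2 x b c = (1 - s) * area2 a b c" "area2 a x c = s * area2 a b c" "area2 a b x = 0"
    unfolding s by (simp_all add: area2_def algebra_simps)
  have "0 < area2 (?y 0) b c" "0 < area2 a (?y 0) c"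
    unfolding y0 v using s pos by simp_all
  then have "\<forall>\<^sub>F e in at_right 0. 0 < area2 (?y e) b c" "\<forall>\<^sub>F e in at_right 0. 0 < area2 a (?y e) c"
    using tend order_tendstoD(1) by blast+
  moreover have "\<forall>\<^sub>F e in at_right 0. 0 < (e::real)"
    by (simp add: eventually_at_right_less)
  ultimately show ?thesis
  proof eventually_elim
    case (elim e)
    have "area2 a b (?y e) = area2 a b x + e * dist a b * (onormal a b \<bullet> onormal a b)"
    proof -
      have "- area2 a b (?y e) / dist a b = - area2 a b x / dist a b - e * (onormal a b \<bullet> onormal a b)"
        unfolding inner_onormal[symmetric] by (simp add: inner_diff_right)
      then show ?thesis using tri_distinct by (simp add: field_simps)
    qed
    also have "\<dots> = e * dist a b"
      using norm_onormal[of a b] tri_distinct by (simp add: v norm_eq_1)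
    finally have "0 < area2 a b (?y e)" using elim tri_distinct by simp
    then show ?case using elim tri_interiorI by blast
  qed
qed

end

text \<open>After a cyclic rotation of the vertices any given edge is \<open>ab\<close>.\<close>

lemma edge_tri:
  fixes K :: "point set"
  assumes "2 simplex K" "E edge_of K"
  obtains a b c where "tri K a b c" "E = closed_segment a b"
proof -
  obtain a b c where "tri K a b c" using simplex_2_tri assms(1) by blast
  moreover from this have "tri K b c a" "tri K c a b" by (auto dest: tri_rotate)
  ultimately show thesis using tri_edge[of K a b c] assms(2) that by auto
qed

text \<open>\<open>edge_ends\<close> is a choice, so the order of the end points is unknown and only
  symmetric expressions in them are determined.\<close>

lemma edge_ends_cases:
  fixes a b :: point
  shows "edge_ends (closed_segment a b) = (a, b) \<or> edge_ends (closed_segment a b) = (b, a)"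
proof -
  have "closed_segment a b = closed_segment (fst (edge_ends (closed_segment a b))) (snd (edge_ends (closed_segment a b)))"
    unfolding edge_ends_def by (rule someI[of _ "(a, b)"]) simp
  then show ?thesis
    by (auto simp: doubleton_eq_iff prod_eq_iff)
qed

lemma edge_length_segment: "edge_length (closed_segment a b) = dist a (b::point)"
  using edge_ends_cases[of a b] by (auto simp: edge_length_def dist_commute)

lemma edge_midpoint_segment: "edge_midpoint (closed_segment a b) = midpoint a (b::point)"
  using edge_ends_cases[of a b] by (auto simp: edge_midpoint_def midpoint_sym)

section \<open>The Morley element\<close>

text \<open>\<open>b - a\<close> and \<open>n\<close> form an orthogonal basis of the plane. This
  serves both the uniqueness of the Morley interpolant and the identification of its midpoint
  gradients.\<close>

lemma normal_tangential_eqI: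
  fixes g g' :: "2 \<Rightarrow> real"
  assumes "a \<noteq> b" "norm n = 1" "n \<bullet> (b - a) = 0"
    and "(\<Sum>i\<in>UNIV. g i * (b - a) $ i) = (\<Sum>i\<in>UNIV. g' i * (b - a) $ i)"
    and "(\<Sum>i\<in>UNIV. g i * n $ i) = (\<Sum>i\<in>UNIV. g' i * n $ i)"
  shows "g i = g' i"
proof -
  define d where "d = b - a"
  define k where "k = (\<lambda>i. g i - g' i)"
  have d: "(d $ 1)^2 + (d $ 2)^2 \<noteq> 0"
    using assms(1) by (auto simp: d_def point_eq_iff sum_power2_eq_zero_iff)
  have t: "k 1 * d $ 1 + k 2 * d $ 2 = 0"
    using assms(4) by (simp add: k_def d_def sum_2 algebra_simps)
  have "(\<Sum>i\<in>UNIV. k i * n $ i) = 0"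
    using assms(5) by (simp add: k_def sum_2 algebra_simps)
  then have "(\<Sum>i\<in>UNIV. k i * onormal a b $ i) = 0"
    using unit_perp_cases[OF assms(1-3)] by (auto simp: sum_negf)
  then have "1 / dist a b * (k 1 * d $ 2 - k 2 * d $ 1) = 0"
    by (simp add: sum_2 onormal_def tangent_def d_def diff_divide_distrib add_divide_distrib algebra_simps)
  then have n: "k 1 * d $ 2 - k 2 * d $ 1 = 0"
    using assms(1) by simp
  have "((d $ 1)^2 + (d $ 2)^2) * k 1 = 0" "((d $ 1)^2 + (d $ 2)^2) * k 2 = 0"
    using t n by algebra+
  then show ?thesis using d exhaust_2[of i] by (auto simp: k_def)
qed

text \<open>The midpoint rule is exact on each edge because \<open>p\<^sub>,\<^sub>i\<close> is affine; \<open>tangent (b - a)\<close> is the outer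
  normal scaled by the edge length.\<close>

lemma tri_divergence:
  assumes "p \<in> polys 2"
  shows "area2 a b c / 2 * hess p i j =
    pd i p (midpoint a b) * tangent (b - a) $ j + pd i p (midpoint b c) * tangent (c - b) $ j
    + pd i p (midpoint c a) * tangent (a - c) $ j"
proof -
  have "pd i p \<in> polys 1" by (rule pd_polys_2[OF assms])
  then obtain c0 b1 b2 where q: "pd i p = quad c0 b1 b2 0 0 0"
    by (auto simp only: polys_1_iff)
  have "hess p i j = (if j = 1 then b1 else b2)"
    using exhaust_2[of j] by (auto simp: hess_def curvature_def q pd_quad) (auto simp: quad_def)
  then show ?thesis
    using exhaust_2[of j]
    by (auto simp: q quad_def area2_def tangent_def midpoint_def field_simps)
qed

lemma divergence:
  fixes K :: "point set"
  assumes "2 simplex K" "p \<in> polys 2"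
  shows "(\<Sum>E | E edge_of K. edge_length E * (pd i p (edge_midpoint E) * outer_normal K E $ j)) =
         measure lebesgue K * hess p i j"
proof -
  obtain a b c where t: "tri K a b c" using simplex_2_tri assms(1) by blast
  have t': "tri K b c a" "tri K c a b" using t by (auto dest: tri_rotate)
  have "dist a b * (g * onormal a b $ j) = g * tangent (b - a) $ j" if "a \<noteq> b" for a b g
    using that by (simp add: onormal_def field_simps)
  note this[OF tri_distinct(1)[OF t]] this[OF tri_distinct(2)[OF t]] this[OF tri_distinct(3)[OF t]]
  then show ?thesis
    using tri_divergence[OF assms(2), of a b c i j]
    by (simp only: tri_sum_edges[OF t] tri_measure[OF t] edge_length_segment edge_midpoint_segment
        tri_outer_normal[OF t] tri_outer_normal[OF t'(1)] tri_outer_normal[OF t'(2)])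
qed

section \<open>The element form of two quadratics\<close>

lemma elem_ip_const:
  assumes "compact K"
  shows "elem_ip K (\<lambda>_. c) (\<lambda>_. d) = measure lebesgue K * (c * d)"
proof -
  have "K \<in> lmeasurable" using assms by (rule lmeasurable_compact)
  then show ?thesis
    by (simp add: elem_ip_def set_lebesgue_integral_def)
qed

lemma aK_polys_2:
  fixes K :: "point set"
  assumes "2 simplex K" "p \<in> polys 2" "q \<in> polys 2"
  shows "aK lam mu K p q =
    measure lebesgue K * (\<Sum>i\<in>UNIV. \<Sum>j\<in>UNIV. stress_const lam mu p i j * hess q i j)"
  using elem_ip_const[OF compact_simplex[OF assms(1)]]
  by (simp add: aK_def stress_polys_2 curvature_polys_2 assms(2,3) sum_distrib_left)

text \<open>\<open>divergence\<close> turns each of the two edge sums into the area times an element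
  constant; the prefactor of \<open>bpt_form\<close> cancels one of the two areas, and the other is
  that of the integral in \<open>aK\<close>.\<close>

lemma aK_eq_bpt_form:
  fixes K :: "point set"
  assumes K: "2 simplex K" and p: "p \<in> polys 2" and q: "q \<in> polys 2"
    and U: "\<And>E i. E edge_of K \<Longrightarrow> avg_pd M E i U = pd i p (edge_midpoint E)"
    and v: "\<And>E i. E edge_of K \<Longrightarrow> avg_pd M E i v = pd i q (edge_midpoint E)"
  shows "aK lam mu K p q = bpt_form M lam mu K U v"
proof -
  let ?m = "measure lebesgue K"
  have V: "(\<Sum>E | E edge_of K. edge_length E * (avg_pd M E i v * outer_normal K E $ j)) = ?m * hess q i j" for i j
    using divergence[OF K q, of i j] v by (auto intro: sum.cong)
  have W: "(\<Sum>E | E edge_of K. edge_length E * (avg_pd M E i U * outer_normal K E $ j)) = ?m * hess p i j" for i j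
    using divergence[OF K p, of i j] U by (auto intro: sum.cong)
  \<comment> \<open>The normal derivative sums \<open>avg_pd M E k U\<close> times the
    \<open>k\<close>-th normal component, so this is the trace of the sums in
    \<open>W\<close>.\<close>
  have N: "(\<Sum>E | E edge_of K. edge_length E * avg_nd M E (outer_normal K E) U) = ?m * (\<Sum>k\<in>UNIV. hess p k k)"
    unfolding avg_nd_def sum_distrib_left
    by (subst sum.swap) (simp only: W flip: sum_distrib_left)
  have S: "(\<Sum>E | E edge_of K. edge_length E *
           (lam * avg_nd M E (outer_normal K E) U * kron i j
            + mu * avg_pd M E i U * outer_normal K E $ j)) = ?m * stress_const lam mu p i j" for i j
  proof -
    have "(\<Sum>E | E edge_of K. edge_length E *
           (lam * avg_nd M E (outer_normal K E) U * kron i j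
            + mu * avg_pd M E i U * outer_normal K E $ j)) =
       lam * kron i j * (\<Sum>E | E edge_of K. edge_length E * avg_nd M E (outer_normal K E) U)
       + mu * (\<Sum>E | E edge_of K. edge_length E * (avg_pd M E i U * outer_normal K E $ j))"
      unfolding sum_distrib_left sum.distrib[symmetric]
      by (rule sum.cong) (auto simp: algebra_simps)
    then show ?thesis
      unfolding N W by (simp add: stress_const_def algebra_simps)
  qed
  obtain a b c where "tri K a b c" using simplex_2_tri K by blast
  then have "?m > 0" using tri_measure by (force simp: tri_def)
  then show ?thesis
    unfolding aK_polys_2[OF K p q] bpt_form_def S V
    by (simp add: sum_distrib_left algebra_simps)
qed

section \<open>Unisolvence of the Morley element\<close>

lemma normal_deriv_add:
  "p \<in> polys 2 \<Longrightarrow> q \<in> polys 2 \<Longrightarrow> normal_deriv n (\<lambda>x. p x + q x) x = normal_deriv n p x + normal_deriv n q x"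
  by (simp add: normal_deriv_def pd_add_polys_2 algebra_simps sum.distrib)

lemma normal_deriv_diff:
  "p \<in> polys 2 \<Longrightarrow> q \<in> polys 2 \<Longrightarrow> normal_deriv n (\<lambda>x. p x - q x) x = normal_deriv n p x - normal_deriv n q x"
  by (simp add: normal_deriv_def pd_diff_polys_2 algebra_simps sum_subtractf)

lemma morley_bubble:
  assumes t: "tri K a b c" and n: "norm n = 1" "n \<bullet> (b - a) = 0"
  obtains p where "p \<in> polys 2" "p a = 0" "p b = 0" "p c = 0"
    "normal_deriv n p (midpoint a b) = s"
    "\<And>m. normal_deriv m p (midpoint b c) = 0" "\<And>m. normal_deriv m p (midpoint c a) = 0"
proof -
  have pos: "0 < area2 a b c" and ab: "a \<noteq> b" using t tri_distinct by (auto simp: tri_def)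
  text \<open>With \<open>l\<close> the barycentric coordinate of \<open>c\<close>, the gradient of \<open>l * (l - 1)\<close> is \<open>2 * l - 1\<close> times
    that of \<open>l\<close>, so it vanishes at the midpoints of the two edges through \<open>c\<close>, where \<open>l = 1 / 2\<close>.\<close>
  define k where "k = (- dist a b / area2 a b c) *\<^sub>R onormal a b"
  define l where "l = (\<lambda>x. - (k \<bullet> a) + k \<bullet> x)"
  have l_area: "l x = area2 a b x / area2 a b c" for x
  proof -
    have "l x = k \<bullet> (x - a)" by (simp add: l_def inner_diff_right)
    then show ?thesis using ab pos inner_onormal[of a b x] by (simp add: k_def)
  qed
  have l_abc: "l a = 0" "l b = 0" "l c = 1"
    using pos by (simp_all add: l_area) (simp_all add: area2_def)
  have "l (midpoint x y) = 1/2 * (l x + l y)" for x y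
    by (simp add: l_def midpoint_def inner_right_distrib field_simps)
  from this[of a b] this[of b c] this[of c a] have l_mid: "l (midpoint a b) = 0" "l (midpoint b c) = 1/2" "l (midpoint c a) = 1/2"
    unfolding l_abc by simp_all
  define f where "f = (\<lambda>x. (- (k \<bullet> a) + k \<bullet> x) * ((- (k \<bullet> a) - 1) + k \<bullet> x))"
  have f: "f \<in> polys 2" unfolding f_def by (intro polys_1_mult polys_1_affine)
  have fl: "f x = l x * (l x - 1)" for x by (simp add: f_def l_def algebra_simps)
  have pdf: "pd i f x = (2 * l x - 1) * k $ i" for i x
    unfolding f_def pd_affine_mult by (simp add: l_def algebra_simps)
  have nf: "normal_deriv m f x = (2 * l x - 1) * (k \<bullet> m)" for m x
    unfolding normal_deriv_def pdf by (simp add: inner_vec_def sum_2 algebra_simps)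
  have "onormal a b \<bullet> onormal a b = 1" using norm_onormal[OF ab] by (simp add: norm_eq_1)
  then have kn: "k \<bullet> n \<noteq> 0"
    using unit_perp_cases[OF ab n] ab pos by (auto simp: k_def)
  \<comment> \<open>At the midpoint of \<open>ab\<close> the function \<open>l\<close> is 0, so the
    normal derivative of \<open>f\<close> there is \<open>- (k \<bullet> n)\<close>; the factor
    normalizes it to \<open>s\<close> for either sign of \<open>n\<close>.\<close>
  define p where "p = (\<lambda>x. (- s / (k \<bullet> n)) * f x)"
  have "normal_deriv m p x = (- s / (k \<bullet> n)) * normal_deriv m f x" for m x
    unfolding normal_deriv_def p_def pd_scale_polys_2[OF f]
    by (simp only: sum_distrib_left mult.assoc)
  then have np: "normal_deriv m p x = (- s / (k \<bullet> n)) * ((2 * l x - 1) * (k \<bullet> m))" for m x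
    by (simp only: nf)
  have "p \<in> polys 2" unfolding p_def by (rule polys_2_scale[OF f])
  moreover have "p a = 0" "p b = 0" "p c = 0" by (simp_all add: p_def fl l_abc)
  moreover have "normal_deriv n p (midpoint a b) = s"
    unfolding np l_mid using kn by simp
  moreover have "normal_deriv m p (midpoint b c) = 0" "normal_deriv m p (midpoint c a) = 0" for m
    unfolding np l_mid by simp_all
  ultimately show thesis using that by blast
qed

lemma affine_interpolation:
  assumes t: "tri K a b c"
  obtains p where "p \<in> polys 1" "p a = va" "p b = vb" "p c = vc"
proof -
  have pos: "area2 a b c \<noteq> 0" using t by (auto simp: tri_def)
  \<comment> \<open>Cramer's rule for the gradient with prescribed differences
    \<open>vb - va\<close> along \<open>b - a\<close> and \<open>vc - va\<close> along
    \<open>c - a\<close>.\<close>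
  define k :: point where "k = vector
    [((vb - va) * (c$2 - a$2) - (vc - va) * (b$2 - a$2)) / area2 a b c,
     ((vc - va) * (b$1 - a$1) - (vb - va) * (c$1 - a$1)) / area2 a b c]"
  have k: "k \<bullet> x = k $ 1 * x $ 1 + k $ 2 * x $ 2" for x
    by (simp add: inner_vec_def sum_2)
  have *: "area2 a b c * (k $ 1) = (vb - va) * (c$2 - a$2) - (vc - va) * (b$2 - a$2)"
       "area2 a b c * (k $ 2) = (vc - va) * (b$1 - a$1) - (vb - va) * (c$1 - a$1)"
    using pos by (simp_all add: k_def)
  have "area2 a b c * (k \<bullet> b - k \<bullet> a) = area2 a b c * (vb - va)"
       "area2 a b c * (k \<bullet> c - k \<bullet> a) = area2 a b c * (vc - va)"
    unfolding k using * unfolding area2_def by algebra+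
  then have "k \<bullet> b - k \<bullet> a = vb - va" "k \<bullet> c - k \<bullet> a = vc - va" using pos by simp_all
  then show thesis
    using that[of "\<lambda>x. (va - k \<bullet> a) + k \<bullet> x"] polys_1_affine by simp
qed

text \<open>The six degrees of freedom. The normals are parameters because the mesh fixes one normal
  per edge, which may be inward for this triangle.\<close>

definition morley_conditions ::
  "point \<Rightarrow> point \<Rightarrow> point \<Rightarrow> point \<Rightarrow> point \<Rightarrow> point \<Rightarrow>
   real \<Rightarrow> real \<Rightarrow> real \<Rightarrow> real \<Rightarrow> real \<Rightarrow> real \<Rightarrow> (point \<Rightarrow> real) \<Rightarrow> bool" where
  "morley_conditions a b c n1 n2 n3 va vb vc s1 s2 s3 p \<longleftrightarrow> p \<in> polys 2 \<and>
     p a = va \<and> p b = vb \<and> p c = vc \<and> normal_deriv n1 p (midpoint a b) = s1 \<and>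
     normal_deriv n2 p (midpoint b c) = s2 \<and> normal_deriv n3 p (midpoint c a) = s3"

context
  fixes K a b c n1 n2 n3
  assumes t: "tri K a b c" and n1: "norm n1 = 1" "n1 \<bullet> (b - a) = 0"
    and n2: "norm n2 = 1" "n2 \<bullet> (c - b) = 0" and n3: "norm n3 = 1" "n3 \<bullet> (a - c) = 0"
begin

text \<open>Each edge function corrects the normal derivative of the affine interpolant at one
  midpoint and leaves the other five degrees of freedom alone.\<close>

lemma morley_exists: "\<exists>p. morley_conditions a b c n1 n2 n3 va vb vc s1 s2 s3 p"
proof -
  have t': "tri K b c a" "tri K c a b" using t by (auto dest: tri_rotate)
  obtain p0 where p0: "p0 \<in> polys 1" "p0 a = va" "p0 b = vb" "p0 c = vc"
    by (rule affine_interpolation[OF t])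
  then have p02: "p0 \<in> polys 2" by (intro polys_1_subset_2)
  obtain p1 where p1: "p1 \<in> polys 2" "p1 a = 0" "p1 b = 0" "p1 c = 0"
    "normal_deriv n1 p1 (midpoint a b) = s1 - normal_deriv n1 p0 (midpoint a b)"
    "\<And>m. normal_deriv m p1 (midpoint b c) = 0" "\<And>m. normal_deriv m p1 (midpoint c a) = 0"
    using morley_bubble[OF t n1] by metis
  obtain p2 where p2: "p2 \<in> polys 2" "p2 a = 0" "p2 b = 0" "p2 c = 0"
    "normal_deriv n2 p2 (midpoint b c) = s2 - normal_deriv n2 p0 (midpoint b c)"
    "\<And>m. normal_deriv m p2 (midpoint c a) = 0" "\<And>m. normal_deriv m p2 (midpoint a b) = 0"
    using morley_bubble[OF t'(1) n2] by metis
  obtain p3 where p3: "p3 \<in> polys 2" "p3 a = 0" "p3 b = 0" "p3 c = 0"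
    "normal_deriv n3 p3 (midpoint c a) = s3 - normal_deriv n3 p0 (midpoint c a)"
    "\<And>m. normal_deriv m p3 (midpoint a b) = 0" "\<And>m. normal_deriv m p3 (midpoint b c) = 0"
    using morley_bubble[OF t'(2) n3] by metis
  note q1 = polys_2_add[OF p02 p1(1)]
  note q2 = polys_2_add[OF q1 p2(1)]
  show ?thesis
    unfolding morley_conditions_def
    using polys_2_add[OF q2 p3(1)]
    by (intro exI[of _ "\<lambda>x. p0 x + p1 x + p2 x + p3 x"])
       (simp add: normal_deriv_add[OF q2 p3(1)] normal_deriv_add[OF q1 p2(1)]
         normal_deriv_add[OF p02 p1(1)] p0 p1 p2 p3)
qed

text \<open>Equal nodal values kill the tangential derivatives at the midpoints, so the whole
  gradient vanishes there. By \<open>tri_divergence\<close> the Hessian vanishes too, the gradient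
  is zero everywhere, and \<open>p a = 0\<close> finishes.\<close>

lemma morley_zero:
  assumes "morley_conditions a b c n1 n2 n3 0 0 0 0 0 0 p"
  shows "p = (\<lambda>_. 0)"
proof -
  have p: "p \<in> polys 2" "p a = 0" "p b = 0" "p c = 0" "normal_deriv n1 p (midpoint a b) = 0"
     "normal_deriv n2 p (midpoint b c) = 0" "normal_deriv n3 p (midpoint c a) = 0"
    using assms by (auto simp: morley_conditions_def)
  have zero: "pd i p (midpoint x y) = 0"
    if "x \<noteq> y" "norm n = 1" "n \<bullet> (y - x) = 0" "p x = 0" "p y = 0" "normal_deriv n p (midpoint x y) = 0"
    for x y n i
    using normal_tangential_eqI[OF that(1-3), of "\<lambda>i. pd i p (midpoint x y)" "\<lambda>_. 0" i]
      polys_2_midpoint_diff[OF p(1), of y x] that(4-) by (simp add: normal_deriv_def)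
  have g: "pd i p (midpoint a b) = 0" "pd i p (midpoint b c) = 0" "pd i p (midpoint c a) = 0" for i
    using zero[OF _ n1] zero[OF _ n2] zero[OF _ n3] p tri_distinct[OF t] by auto
  have "hess p i j = 0" for i j
    using tri_divergence[OF p(1), of a b c i j] t by (simp add: g tri_def)
  then have "pd i p x = 0" for i x
    using pd_polys_2_diff[OF p(1), of i x "midpoint a b"] by (simp add: g)
  then have "p x = 0" for x
    using polys_2_midpoint_diff[OF p(1), of x a] p(2) by simp
  then show ?thesis by auto
qed

lemma morley_unique:
  assumes p: "morley_conditions a b c n1 n2 n3 va vb vc s1 s2 s3 p"
    and q: "morley_conditions a b c n1 n2 n3 va vb vc s1 s2 s3 q"
  shows "p = q"
proof -
  have "morley_conditions a b c n1 n2 n3 0 0 0 0 0 0 (\<lambda>x. p x - q x)"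
    using p q by (auto simp: morley_conditions_def polys_2_diff normal_deriv_diff)
  then have "(\<lambda>x. p x - q x) = (\<lambda>_. 0)" by (rule morley_zero)
  then show ?thesis by (simp add: fun_eq_iff)
qed

end

lemma morley_loc_characterization:
  fixes K :: "point set"
  assumes K: "2 simplex K"
    and n: "\<And>E. E edge_of K \<Longrightarrow> norm (enormal M E) = 1 \<and> (\<forall>x\<in>E. \<forall>y\<in>E. enormal M E \<bullet> (y - x) = 0)"
  shows "morley_loc M K v \<in> polys 2 \<and>
     (\<forall>x. x extreme_point_of K \<longrightarrow> morley_loc M K v x = fst v x) \<and>
     (\<forall>E. E edge_of K \<longrightarrow>
        normal_deriv (enormal M E) (morley_loc M K v) (edge_midpoint E) = avg_nd M E (enormal M E) v)"
    (is "?P (morley_loc M K v)")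
proof -
  obtain a b c where t: "tri K a b c" using simplex_2_tri K by blast
  let ?n = "enormal M" and ?s = closed_segment
  let ?m = "morley_conditions a b c (?n (?s a b)) (?n (?s b c)) (?n (?s c a)) (fst v a) (fst v b) (fst v c)
     (avg_nd M (?s a b) (?n (?s a b)) v) (avg_nd M (?s b c) (?n (?s b c)) v) (avg_nd M (?s c a) (?n (?s c a)) v)"
  have P: "?P p \<longleftrightarrow> ?m p" for p
    by (auto simp: morley_conditions_def tri_extreme_point[OF t] tri_edge[OF t] edge_midpoint_segment)
  have n': "norm (?n (?s a b)) = 1" "?n (?s a b) \<bullet> (b - a) = 0"
     "norm (?n (?s b c)) = 1" "?n (?s b c) \<bullet> (c - b) = 0"
     "norm (?n (?s c a)) = 1" "?n (?s c a) \<bullet> (a - c) = 0"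
    using n[of "?s a b"] n[of "?s b c"] n[of "?s c a"] by (auto simp: tri_edge[OF t])
  have "\<exists>!p. ?m p"
    using morley_exists[OF t n'] morley_unique[OF t n'] by blast
  then have "\<exists>!p. ?P p" unfolding P .
  then show ?thesis unfolding morley_loc_def by (rule theI')
qed

section \<open>The mesh\<close>

text \<open>A nonempty interior makes the constant described by \<open>tri_pd\<close>
  unique.\<close>

lemma tri_pd_affine:
  assumes p: "p \<in> polys 1" and w: "\<And>x. x \<in> K \<Longrightarrow> w x = p x" and K: "interior K \<noteq> {}"
  shows "tri_pd K i w = pd i p 0"
proof -
  have "pd i w x = pd i p x" if "x \<in> interior K" for x
    by (rule pd_cong_open[OF open_interior _ that]) (use w interior_subset in blast)
  moreover have "pd i p x = pd i p 0" for x
    using p exhaust_2[of i] unfolding polys_1_iff by (auto simp: pd_quad) (auto simp: quad_def)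
  ultimately have "pd i w x = pd i p 0" if "x \<in> interior K" for x
    using that by metis
  then show ?thesis
    unfolding tri_pd_def using K by (intro the_equality) fastforce+
qed

lemma tri_pd_diff:
  assumes p: "p \<in> polys 1" "\<And>x. x \<in> K \<Longrightarrow> w x = p x" and K: "interior K \<noteq> {}" and x: "x \<in> K" "y \<in> K"
  shows "(\<Sum>i\<in>UNIV. tri_pd K i w * (y - x) $ i) = w y - w x"
  using polys_1_diff[OF p(1), of y x 0] by (simp add: tri_pd_affine[OF p K] p(2) x)

lemma tri_interior_nonempty: "tri K a b c \<Longrightarrow> interior K \<noteq> {}"
proof -
  assume t: "tri K a b c"
  have "\<forall>\<^sub>F e in at_right 0. midpoint a b - e *\<^sub>R onormal a b \<in> interior K"
    by (rule tri_push[OF t]) (use tri_distinct[OF t] in simp)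
  then show ?thesis
    using eventually_happens'[of "at_right (0::real)"] by fastforce
qed

text \<open>The ghost is the image of the triangle under the half-turn about the midpoint of
  \<open>ab\<close>. This preserves orientation and exchanges \<open>a\<close> and \<open>b\<close>,
  hence their reversed order.\<close>

lemma tri_ghost:
  assumes t: "tri (boundary_elem M E) a b c" and E: "E = closed_segment a b"
  shows "tri (ghost M E) b a (a + b - c)"
proof -
  have "c \<notin> closed_segment a b"
  proof
    assume "c \<in> closed_segment a b"
    then obtain s where s: "c = (1 - s) *\<^sub>R a + s *\<^sub>R b" by (auto simp: in_segment)
    have "area2 a b c = 0" unfolding s by (simp add: area2_def algebra_simps)
    with t show False by (simp add: tri_def)
  qed
  then have "(THE x. x extreme_point_of boundary_elem M E \<and> x \<notin> E) = c"
    unfolding tri_extreme_point[OF t] using E by auto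
  then have "ghost M E = convex hull {b, a, a + b - c}"
    using edge_ends_cases[of a b] by (auto simp: ghost_def Let_def E insert_commute add.commute)
  moreover have "area2 b a (a + b - c) = area2 a b c"
    by (simp add: area2_def algebra_simps)
  ultimately show ?thesis using t by (simp add: tri_def)
qed

lemma sum_mean_mult:
  fixes f g h :: "'i \<Rightarrow> real"
  shows "(\<Sum>i\<in>I. (f i + g i) * h i / 2) = ((\<Sum>i\<in>I. f i * h i) + (\<Sum>i\<in>I. g i * h i)) / 2"
  by (simp add: distrib_right sum.distrib flip: sum_divide_distrib)

context
  fixes M :: plate_mesh
  assumes M: "plate_triangulation M"
begin

lemma elem_simplex: "K \<in> elems M \<Longrightarrow> 2 simplex K"
  using M by (simp add: plate_triangulation_def)

lemma finite_elems: "finite (elems M)"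
  using M by (simp add: plate_triangulation_def triangulation_def)

lemma elem_face: "K \<in> elems M \<Longrightarrow> K' \<in> elems M \<Longrightarrow> K \<inter> K' face_of K"
  using M by (simp add: plate_triangulation_def triangulation_def)

lemma enormal_unit: "K \<in> elems M \<Longrightarrow> E edge_of K \<Longrightarrow> norm (enormal M E) = 1"
  and enormal_perp: "K \<in> elems M \<Longrightarrow> E edge_of K \<Longrightarrow> x \<in> E \<Longrightarrow> y \<in> E \<Longrightarrow> enormal M E \<bullet> (y - x) = 0"
  using M by (auto simp: plate_triangulation_def edges_def)

lemma boundary_edge_normal:
  "E \<in> boundary_edges M \<Longrightarrow> K \<in> elems M \<Longrightarrow> E edge_of K \<Longrightarrow> enormal M E = outer_normal K E"
  using M by (simp add: plate_triangulation_def)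

lemma elem_interior_nonempty: "K \<in> elems M \<Longrightarrow> interior K \<noteq> {}"
  using simplex_2_tri elem_simplex tri_interior_nonempty by metis

text \<open>A face that meets the interior is the whole set. Conformity makes the intersection a
  face of both elements, so it equals each of them.\<close>

lemma interior_elem_unique:
  assumes "K \<in> elems M" "K' \<in> elems M" "x \<in> interior K" "x \<in> K'"
  shows "K' = K"
proof -
  have "K \<inter> K' = K"
    using face_of_disjoint_interior[OF elem_face[OF assms(1,2)]] assms(3,4) interior_subset by blast
  then have sub: "K \<subseteq> K'" by blast
  have "K' \<inter> K \<inter> interior K' \<noteq> {}"
    using interior_mono[OF sub] assms(3) interior_subset sub by blast
  then have "K' \<inter> K = K'"
    using face_of_disjoint_interior[OF elem_face[OF assms(2,1)]] by blast
  with sub show ?thesis by blast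
qed

lemma elem_push:
  assumes "K \<in> elems M" "E edge_of K" "x \<in> E" "\<not> x extreme_point_of E"
  shows "\<forall>\<^sub>F e in at_right 0. x - e *\<^sub>R outer_normal K E \<in> interior K"
proof -
  obtain a b c where t: "tri K a b c" "E = closed_segment a b"
    using edge_tri elem_simplex assms(1,2) by metis
  then have "x \<in> open_segment a b"
    using assms(3,4) by (auto simp: open_segment_def segment_convex_hull extreme_point_of_convex_hull_2)
  then show ?thesis using tri_push[OF t(1)] by (simp add: t(2) tri_outer_normal[OF t(1)])
qed

lemma edge_midpoint_inner:
  assumes "K \<in> elems M" "E edge_of K"
  shows "edge_midpoint E \<in> E" "\<not> edge_midpoint E extreme_point_of E"
proof -
  obtain a b c where t: "tri K a b c" "E = closed_segment a b"
    using edge_tri elem_simplex assms by metis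
  show "edge_midpoint E \<in> E"
    by (simp add: t(2) edge_midpoint_segment)
  have "midpoint a b \<noteq> a" "midpoint a b \<noteq> b" using tri_distinct[OF t(1)] by auto
  then show "\<not> edge_midpoint E extreme_point_of E"
    unfolding t(2) edge_midpoint_segment by (simp add: segment_convex_hull extreme_point_of_convex_hull_2)
qed

text \<open>Pushing the midpoint of \<open>E\<close> against the common normal enters both interiors
  at once.\<close>

lemma elem_unique_of_normal:
  assumes "K \<in> elems M" "K' \<in> elems M" "E edge_of K" "E edge_of K'"
    and "outer_normal K E = outer_normal K' E"
  shows "K = K'"
proof -
  let ?x = "edge_midpoint E"
  have "\<forall>\<^sub>F e in at_right 0. ?x - e *\<^sub>R outer_normal K E \<in> interior K"
    "\<forall>\<^sub>F e in at_right 0. ?x - e *\<^sub>R outer_normal K E \<in> interior K'"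
    using elem_push[OF assms(1,3)] elem_push[OF assms(2,4)] edge_midpoint_inner[OF assms(1,3)]
    by (auto simp: assms(5))
  then have "\<forall>\<^sub>F e in at_right 0. ?x - e *\<^sub>R outer_normal K E \<in> interior K \<inter> interior K'"
    by eventually_elim auto
  then obtain e :: real where "?x - e *\<^sub>R outer_normal K E \<in> interior K \<inter> interior K'"
    using eventually_happens'[of "at_right (0::real)"] by fastforce
  then show ?thesis
    using interior_elem_unique[OF assms(1,2)] interior_subset by blast
qed

lemma enormal_cases:
  assumes "K \<in> elems M" "E edge_of K"
  shows "enormal M E = outer_normal K E \<or> enormal M E = - outer_normal K E"
proof -
  obtain a b c where t: "tri K a b c" "E = closed_segment a b"
    using edge_tri elem_simplex assms by metis
  show ?thesis
    using unit_perp_cases[of a b "enormal M E"] tri_distinct[OF t(1)]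
      enormal_unit[OF assms] enormal_perp[OF assms, of a b] t tri_outer_normal[OF t(1)] by auto
qed

text \<open>Each of the two unit normals of \<open>E\<close> is outer for at most one element, so an
  edge with more than one neighbour has exactly two, on opposite sides. \<open>Kp\<close> is the
  side of \<open>trace_plus\<close>.\<close>

lemma interior_edge_elems:
  assumes "E \<in> edges M" "E \<notin> boundary_edges M"
  obtains Kp Km where "Kp \<in> elems M" "Km \<in> elems M" "E edge_of Kp" "E edge_of Km" "Kp \<noteq> Km"
    "{K. K \<in> elems M \<and> E edge_of K} = {Kp, Km}"
    "outer_normal Kp E = enormal M E" "outer_normal Km E = - enormal M E"
proof -
  let ?P = "\<lambda>K. K \<in> elems M \<and> E edge_of K"
  obtain K where K: "?P K" using assms(1) by (auto simp: edges_def)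
  have "\<exists>K'. ?P K' \<and> K' \<noteq> K"
    using K assms(2) unfolding boundary_edges_def by blast
  then obtain K' where K': "?P K'" "K' \<noteq> K" by blast
  have cases: "outer_normal L E = enormal M E \<or> outer_normal L E = - enormal M E" if "?P L" for L
    using enormal_cases[of L E] that by auto
  have uniq: "L = L'" if "?P L" "?P L'" "outer_normal L E = outer_normal L' E" for L L'
    using elem_unique_of_normal that by blast
  have all: "L \<in> {K, K'}" if "?P L" for L
    using cases[OF that] cases[OF K] cases[OF K'(1)] uniq[OF that K] uniq[OF that K'(1)] uniq[OF K K'(1)] K'(2)
    by auto
  have eq: "{L. ?P L} = {K, K'}" "{L. ?P L} = {K', K}"
    using all K K' by blast+
  consider "outer_normal K E = enormal M E" "outer_normal K' E = - enormal M E"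
    | "outer_normal K' E = enormal M E" "outer_normal K E = - enormal M E"
    using cases[OF K] cases[OF K'(1)] uniq[OF K K'(1)] K'(2) by auto
  then show thesis
  proof cases
    case 1 show thesis by (rule that[of K K']) (use K K' eq 1 in auto)
  next
    case 2 show thesis by (rule that[of K' K]) (use K K' eq 2 in auto)
  qed
qed

lemma boundary_elem:
  assumes "E \<in> boundary_edges M"
  shows "boundary_elem M E \<in> elems M" "E edge_of boundary_elem M E"
  using theI'[of "\<lambda>K. K \<in> elems M \<and> E edge_of K"] assms
  unfolding boundary_elem_def boundary_edges_def by auto

lemma CP1_affine:
  assumes "U \<in> CP1 M" "K \<in> elems M"
  shows "\<exists>p\<in>polys 1. \<forall>x\<in>K. fst U x = p x"
  using assms unfolding CP1_def case_prod_unfold mem_Collect_eq by blast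

lemma CP1_ghost:
  assumes "U \<in> CP1 M" "E \<in> boundary_edges M"
  shows "\<exists>p\<in>polys 1. \<forall>x\<in>ghost M E. snd U E x = p x" "\<And>x. x \<in> E \<Longrightarrow> snd U E x = fst U x"
  using assms unfolding CP1_def case_prod_unfold mem_Collect_eq by blast+

lemma CP1_vanishes: "U \<in> CP1 M \<Longrightarrow> E \<in> EC M \<union> ES M \<Longrightarrow> x \<in> E \<Longrightarrow> fst U x = 0"
  unfolding CP1_def case_prod_unfold mem_Collect_eq by blast

lemma tri_pd_elem_diff:
  assumes "U \<in> CP1 M" "K \<in> elems M" "x \<in> K" "y \<in> K"
  shows "(\<Sum>i\<in>UNIV. tri_pd K i (fst U) * (y - x) $ i) = fst U y - fst U x"
proof -
  obtain p where p: "p \<in> polys 1" "\<forall>x\<in>K. fst U x = p x"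
    using CP1_affine[OF assms(1,2)] by (rule bexE)
  show ?thesis
    by (rule tri_pd_diff[OF p(1) bspec[OF p(2)] elem_interior_nonempty[OF assms(2)] assms(3,4)])
qed

text \<open>Each of the two linear pieces reproduces the difference of the values of
  \<open>U\<close> at the end points, hence so does their mean. On a boundary edge the second piece
  is the ghost part, which matches \<open>fst U\<close> on \<open>E\<close>.\<close>

lemma avg_pd_tangential:
  assumes U: "U \<in> CP1 M" and E: "E \<in> edges M" and x: "x extreme_point_of E" "y extreme_point_of E"
  shows "(\<Sum>i\<in>UNIV. avg_pd M E i U * (y - x) $ i) = fst U y - fst U x"
proof (cases "E \<in> boundary_edges M")
  case True
  note K = boundary_elem[OF True]
  have xE: "x \<in> E" "y \<in> E" using x by (auto simp: extreme_point_of_def)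
  have "x \<in> boundary_elem M E" "y \<in> boundary_elem M E"
    using xE edge_of_imp_subset[OF K(2)] by auto
  then have 1: "(\<Sum>i\<in>UNIV. tri_pd (boundary_elem M E) i (fst U) * (y - x) $ i) = fst U y - fst U x"
    using tri_pd_elem_diff[OF U K(1)] by blast
  obtain a b c where t: "tri (boundary_elem M E) a b c" and E: "E = closed_segment a b"
    using edge_tri[OF elem_simplex[OF K(1)] K(2)] by metis
  note g = tri_ghost[OF t E]
  have "x \<in> {a, b}" "y \<in> {a, b}"
    using x by (auto simp: E segment_convex_hull extreme_point_of_convex_hull_2)
  moreover have "{a, b} \<subseteq> ghost M E"
    using g hull_subset[of "{b, a, a + b - c}" convex] unfolding tri_def by blast
  ultimately have xg: "x \<in> ghost M E" "y \<in> ghost M E"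
    by blast+
  obtain p where p: "p \<in> polys 1" "\<forall>x\<in>ghost M E. snd U E x = p x"
    using CP1_ghost(1)[OF U True] by (rule bexE)
  have "(\<Sum>i\<in>UNIV. tri_pd (ghost M E) i (snd U E) * (y - x) $ i) = snd U E y - snd U E x"
    by (rule tri_pd_diff[OF p(1) bspec[OF p(2)] tri_interior_nonempty[OF g] xg])
  moreover have "snd U E x = fst U x" "snd U E y = fst U y"
    using CP1_ghost(2)[OF U True] xE by blast+
  ultimately show ?thesis
    using 1 True by (simp add: avg_pd_def sum_mean_mult)
next
  case False
  obtain Kp Km where K: "Kp \<in> elems M" "Km \<in> elems M" "E edge_of Kp" "E edge_of Km" "Kp \<noteq> Km"
    "{K. K \<in> elems M \<and> E edge_of K} = {Kp, Km}"
    using interior_edge_elems[OF E False] .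
  have "x \<in> Kp" "y \<in> Kp" "x \<in> Km" "y \<in> Km"
    using x edge_of_imp_subset[OF K(3)] edge_of_imp_subset[OF K(4)]
    by (auto simp: extreme_point_of_def)
  then have
    "(\<Sum>i\<in>UNIV. tri_pd Kp i (fst U) * (y - x) $ i) = fst U y - fst U x"
    "(\<Sum>i\<in>UNIV. tri_pd Km i (fst U) * (y - x) $ i) = fst U y - fst U x"
    using tri_pd_elem_diff[OF U] K(1,2) by blast+
  then show ?thesis
    using False K(5) by (simp add: avg_pd_def K(6) sum_mean_mult)
qed

lemma
  assumes "K \<in> elems M"
  shows morley_loc_polys_2: "morley_loc M K v \<in> polys 2"
    and morley_loc_node: "x extreme_point_of K \<Longrightarrow> morley_loc M K v x = fst v x"
    and morley_loc_normal_deriv: "E edge_of K \<Longrightarrow>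
        normal_deriv (enormal M E) (morley_loc M K v) (edge_midpoint E) = avg_nd M E (enormal M E) v"
  using morley_loc_characterization[OF elem_simplex[OF assms], of M v] enormal_unit[OF assms] enormal_perp[OF assms]
  by auto

lemma pd_morley_loc_midpoint:
  assumes U: "U \<in> CP1 M" and K: "K \<in> elems M" and E: "E edge_of K"
  shows "pd i (morley_loc M K U) (edge_midpoint E) = avg_pd M E i U"
proof -
  obtain a b c where t: "tri K a b c" and Eab: "E = closed_segment a b"
    using edge_tri elem_simplex K E by metis
  have ab: "a \<in> E" "b \<in> E" by (simp_all add: Eab)
  have xK: "a extreme_point_of K" "b extreme_point_of K"
    by (simp_all add: tri_extreme_point[OF t])
  have xE: "a extreme_point_of E" "b extreme_point_of E"
    by (simp_all add: Eab segment_convex_hull extreme_point_of_convex_hull_2)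
  have ed: "E \<in> edges M" using K E by (auto simp: edges_def)
  show ?thesis
  proof (rule normal_tangential_eqI[OF tri_distinct(1)[OF t] enormal_unit[OF K E] enormal_perp[OF K E ab]])
    show "(\<Sum>i\<in>UNIV. pd i (morley_loc M K U) (edge_midpoint E) * (b - a) $ i) =
        (\<Sum>i\<in>UNIV. avg_pd M E i U * (b - a) $ i)"
      unfolding avg_pd_tangential[OF U ed xE]
      using polys_2_midpoint_diff[OF morley_loc_polys_2[OF K, of U], of b a] morley_loc_node[OF K] xK
      by (simp add: Eab edge_midpoint_segment)
    show "(\<Sum>i\<in>UNIV. pd i (morley_loc M K U) (edge_midpoint E) * enormal M E $ i) =
        (\<Sum>i\<in>UNIV. avg_pd M E i U * enormal M E $ i)"
      using morley_loc_normal_deriv[OF K E, of U] by (simp add: normal_deriv_def avg_nd_def)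
  qed
qed

lemma aK_morley_loc:
  assumes "U \<in> CP1 M" "v \<in> CP1 M" "K \<in> elems M"
  shows "aK lam mu K (morley_loc M K U) (morley_loc M K v) = bpt_form M lam mu K U v"
  by (rule aK_eq_bpt_form) (simp_all add: assms elem_simplex morley_loc_polys_2 pd_morley_loc_midpoint)

section \<open>The global reconstruction and its nodal continuity\<close>

lemma morley_interior:
  assumes "K \<in> elems M" "x \<in> interior K"
  shows "morley M v x = morley_loc M K v x"
proof -
  have "(SOME K'. K' \<in> elems M \<and> x \<in> K') = K"
    by (rule some_equality) (use assms interior_subset interior_elem_unique in blast)+
  then show ?thesis by (simp add: morley_def)
qed

lemma morley_selects:
  assumes "x \<in> \<Union>(elems M)"
  obtains K where "K \<in> elems M" "x \<in> K" "morley M v x = morley_loc M K v x"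
  using someI_ex[of "\<lambda>K. K \<in> elems M \<and> x \<in> K"] assms unfolding morley_def by blast

text \<open>The intersection is a face of both elements, and the extreme points of a face are those
  of the whole set that lie in it.\<close>

lemma node_extreme_point:
  assumes "K \<in> elems M" "x extreme_point_of K" "K' \<in> elems M" "x \<in> K'"
  shows "x extreme_point_of K'"
  using extreme_point_of_face[OF elem_face[OF assms(1,3)], of x]
    extreme_point_of_face[OF elem_face[OF assms(3,1)], of x] assms
  by (auto simp: Int_commute extreme_point_of_def)

lemma morley_node:
  assumes "K \<in> elems M" "x extreme_point_of K"
  shows "morley M v x = fst v x"
proof -
  have "x \<in> \<Union>(elems M)" using assms by (auto simp: extreme_point_of_def)
  then obtain K' where "K' \<in> elems M" "x \<in> K'" "morley M v x = morley_loc M K' v x"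
    by (rule morley_selects)
  then show ?thesis using node_extreme_point[OF assms] morley_loc_node by simp
qed

text \<open>All local polynomials of elements through \<open>x\<close> have the same value at
  \<open>x\<close>, and the other elements are closed and stay away from it. There are finitely many
  elements, so one neighbourhood works whichever element \<open>morley\<close> selects.\<close>

lemma morley_continuous_at_node:
  assumes "x \<in> mesh_nodes M"
  shows "continuous (at x within \<Union>(elems M)) (morley M v)"
proof -
  obtain K where K: "K \<in> elems M" "x extreme_point_of K"
    using assms by (auto simp: mesh_nodes_def)
  have fx: "morley M v x = fst v x" by (rule morley_node[OF K])
  have lim: "\<forall>\<^sub>F y in at x within \<Union>(elems M). y \<in> L \<longrightarrow> dist (morley_loc M L v y) (morley M v x) < e"
    if L: "L \<in> elems M" and e: "e > 0" for L e
  proof (cases "x \<in> L")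
    case True
    then have "morley_loc M L v x = morley M v x"
      using fx morley_loc_node[OF L] node_extreme_point[OF K L] by simp
    moreover have "isCont (morley_loc M L v) x"
      using polys_2_continuous[OF morley_loc_polys_2[OF L], of UNIV v]
      by (simp add: continuous_on_eq_continuous_at)
    ultimately have "(morley_loc M L v \<longlongrightarrow> morley M v x) (at x)"
      by (simp add: isCont_def)
    then have "(morley_loc M L v \<longlongrightarrow> morley M v x) (at x within \<Union>(elems M))"
      using tendsto_within_subset by blast
    then show ?thesis using e by (auto dest: tendstoD elim: eventually_mono)
  next
    case False
    have "open (- L)" using elem_simplex[OF L] closed_simplex by auto
    then have "\<forall>\<^sub>F y in at x within \<Union>(elems M). y \<in> - L"
      using False eventually_at_topological by blast
    then show ?thesis by eventually_elim auto
  qed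
  have "\<forall>\<^sub>F y in at x within \<Union>(elems M). dist (morley M v y) (morley M v x) < e" if "e > 0" for e
  proof -
    have "\<forall>\<^sub>F y in at x within \<Union>(elems M). \<forall>L\<in>elems M. y \<in> L \<longrightarrow> dist (morley_loc M L v y) (morley M v x) < e"
      using finite_elems lim that by (auto intro!: eventually_ball_finite)
    moreover have "\<forall>\<^sub>F y in at x within \<Union>(elems M). y \<in> \<Union>(elems M)"
      by (auto simp: eventually_at_filter)
    ultimately show ?thesis
    proof eventually_elim
      case (elim y)
      then show ?case using morley_selects[of y v] by metis
    qed
  qed
  then show ?thesis
    unfolding continuous_within by (intro tendstoI) auto
qed

lemma morley_DPV:
  assumes v: "v \<in> CP1 M"
  shows "morley M v \<in> DPV M"
proof -
  have "\<exists>p\<in>polys 2. \<forall>x\<in>interior K. morley M v x = p x" if "K \<in> elems M" for K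
    using morley_interior[OF that] morley_loc_polys_2[OF that] by blast
  moreover have "morley M v x = 0" if E: "E \<in> EC M \<union> ES M" and x: "x extreme_point_of E" for E x
  proof -
    have "E \<in> boundary_edges M" using E by (auto simp: EC_def ES_def)
    note K = boundary_elem[OF this]
    have "E face_of boundary_elem M E" using K(2) by (simp add: edge_of_def)
    then have "x extreme_point_of boundary_elem M E" using x extreme_point_of_face by blast
    then have "morley M v x = fst v x" by (rule morley_node[OF K(1)])
    also have "\<dots> = 0" using CP1_vanishes[OF v E] x by (simp add: extreme_point_of_def)
    finally show ?thesis .
  qed
  ultimately show ?thesis
    unfolding DPV_def using morley_continuous_at_node by blast
qed

end

section \<open>Edge terms\<close>

lemma polys_1_lincomb: "p \<in> polys 1 \<Longrightarrow> q \<in> polys 1 \<Longrightarrow> (\<lambda>x. k * p x + l * q x) \<in> polys 1"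
proof -
  assume "p \<in> polys 1" "q \<in> polys 1"
  then obtain c b1 b2 c' b1' b2' where
    "p = quad c b1 b2 0 0 0" "q = quad c' b1' b2' 0 0 0"
    unfolding polys_1_iff by blast
  then have "(\<lambda>x. k * p x + l * q x) = quad (k * c + l * c') (k * b1 + l * b1') (k * b2 + l * b2') 0 0 0"
    by (simp add: quad_def fun_eq_iff algebra_simps)
  then show ?thesis unfolding polys_1_iff by blast
qed

lemma polys_1_const: "(\<lambda>_. c) \<in> polys 1"
  using polys_1_affine[of c 0] by simp

lemma polys_1_diff_closed: "p \<in> polys 1 \<Longrightarrow> q \<in> polys 1 \<Longrightarrow> (\<lambda>x. p x - q x) \<in> polys 1"
  using polys_1_lincomb[of p q 1 "-1"] by simp

lemma normal_deriv_polys_1: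
  assumes "p \<in> polys 2"
  shows "normal_deriv n p \<in> polys 1"
  using polys_1_lincomb[OF pd_polys_2[OF assms, of 1] pd_polys_2[OF assms, of 2], of "n $ 1" "n $ 2"]
  by (simp add: normal_deriv_def[abs_def] sum_2 mult.commute)

lemma polys_1_linepath:
  assumes "f \<in> polys 1"
  shows "f (linepath a b s) = (1 - s) * f a + s * f b"
  using assms unfolding polys_1_iff by (auto simp: quad_def linepath_def algebra_simps)

lemma LINT_affine_unit_interval:
  "(LINT s:{0..1}|lebesgue. c * ((1 - s) * \<alpha> + s * \<beta>)) = c * ((\<alpha> + \<beta>) / 2 :: real)"
proof -
  let ?f = "\<lambda>s. c * ((1 - s) * \<alpha> + s * \<beta>)"
  have "?f absolutely_integrable_on {0..1}"
    by (intro absolutely_integrable_continuous_real continuous_intros)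
  then have "(LINT s:{0..1}|lebesgue. ?f s) = integral {0..1} ?f"
    by (rule set_lebesgue_integral_eq_integral(2))
  also define F where "F = (\<lambda>s. c * (s * \<alpha> + s^2 * (\<beta> - \<alpha>) / 2))"
  have "(?f has_integral (F 1 - F 0)) {0..1}"
    unfolding F_def by (rule fundamental_theorem_of_calculus)
       (auto simp: field_simps simp flip: has_real_derivative_iff_has_vector_derivative
         intro!: derivative_eq_intros)
  then have "integral {0..1} ?f = c * ((\<alpha> + \<beta>) / 2)"
    by (simp add: F_def integral_unique field_simps)
  finally show ?thesis .
qed

context
  fixes E :: "point set" and a b
  assumes E: "E = closed_segment a b" and ab: "a \<noteq> b"
begin

text \<open>Traces are controlled away from end points only, and the end points are the null
  parameters 0 and 1. Assuming equality of products permits swapping the factors and replacing both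
  when one of them is zero.\<close>

lemma edge_ip_cong:
  assumes "\<And>x. x \<in> E \<Longrightarrow> \<not> x extreme_point_of E \<Longrightarrow> u x * w x = u' x * w' x"
  shows "edge_ip E u w = edge_ip E u' w'"
proof -
  define g where "g = linepath (fst (edge_ends E)) (snd (edge_ends E))"
  have ends: "edge_ends E = (a, b) \<or> edge_ends E = (b, a)"
    unfolding E by (rule edge_ends_cases)
  have ext: "x extreme_point_of E \<longleftrightarrow> x = a \<or> x = b" for x
    by (simp add: E segment_convex_hull extreme_point_of_convex_hull_2)
  have g: "g s \<in> E \<and> \<not> g s extreme_point_of E" if "0 < s" "s < 1" for s
  proof -
    have 1: "g s \<in> E"
      using ends that linepath_in_path[of s a b] linepath_in_path[of s b a]
      by (auto simp: g_def E closed_segment_commute)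
    have "(1 - s) *\<^sub>R p + s *\<^sub>R q \<noteq> p" "(1 - s) *\<^sub>R p + s *\<^sub>R q \<noteq> q" if "p \<noteq> q" for p q :: point
    proof -
      have "(1 - s) *\<^sub>R p + s *\<^sub>R q - p = s *\<^sub>R (q - p)" "(1 - s) *\<^sub>R p + s *\<^sub>R q - q = (1 - s) *\<^sub>R (p - q)"
        by (simp_all add: algebra_simps)
      then show "(1 - s) *\<^sub>R p + s *\<^sub>R q \<noteq> p" "(1 - s) *\<^sub>R p + s *\<^sub>R q \<noteq> q"
        using that \<open>0 < s\<close> \<open>s < 1\<close> by auto
    qed
    from this[of a b] this[of b a] ends ab have "g s \<noteq> a \<and> g s \<noteq> b"
      by (elim disjE) (simp_all add: g_def linepath_def)
    with 1 show ?thesis by (simp add: ext)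
  qed
  have "(LINT s:{0..1}|lebesgue. u (g s) * w (g s)) = (LINT s:{0..1}|lebesgue. u' (g s) * w' (g s))"
    unfolding set_lebesgue_integral_def
  proof (rule integral_discrete_difference[where X="{0, 1}"])
    fix s :: real assume "s \<notin> {0, 1}"
    then have "s \<in> {0..1} \<Longrightarrow> 0 < s \<and> s < 1" by auto
    then show "indicat_real {0..1} s *\<^sub>R (u (g s) * w (g s)) = indicat_real {0..1} s *\<^sub>R (u' (g s) * w' (g s))"
      using assms g by (auto simp: indicator_def)
  qed auto
  then show ?thesis by (simp add: edge_ip_def g_def Let_def)
qed

lemma edge_ip_const_affine:
  assumes "f \<in> polys 1"
  shows "edge_ip E (\<lambda>_. c) f = edge_length E * (c * f (edge_midpoint E))"
proof -
  let ?p = "fst (edge_ends E)" and ?q = "snd (edge_ends E)"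
  have "linepath ?p ?q (1/2) = edge_midpoint E"
    by (simp add: linepath_def edge_midpoint_def midpoint_def scaleR_add_right)
  then have "f (edge_midpoint E) = (f ?p + f ?q) / 2"
    using polys_1_linepath[OF assms, of ?p ?q "1/2"] by (simp add: field_simps)
  then show ?thesis
    unfolding edge_ip_def Let_def polys_1_linepath[OF assms] LINT_affine_unit_interval by simp
qed

lemma P0_eq_0:
  assumes f: "f \<in> polys 1" "f (edge_midpoint E) = 0"
    and u: "\<And>x. x \<in> E \<Longrightarrow> \<not> x extreme_point_of E \<Longrightarrow> u x = f x"
  shows "P0 E u = (\<lambda>_. 0)"
proof -
  have "edge_ip E (\<lambda>x. u x - c) (\<lambda>_. d) = edge_ip E (\<lambda>_. d) (\<lambda>x. f x - c)" for c d
    by (rule edge_ip_cong) (simp add: u)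
  then have *: "edge_ip E (\<lambda>x. u x - c) (\<lambda>_. d) = - (edge_length E * d * c)" for c d
    using edge_ip_const_affine[OF polys_1_diff_closed[OF f(1) polys_1_const], of d c] f(2) by simp
  have "edge_length E \<noteq> 0" using ab by (simp add: E edge_length_segment)
  \<comment> \<open>Testing with \<open>d = 1\<close> forces the projection constant to be
    0.\<close>
  then have "(THE c. \<forall>d. edge_ip E (\<lambda>x. u x - c) (\<lambda>_. d) = 0) = 0"
    unfolding * by (intro the_equality) (auto dest: spec[of _ 1])
  then show ?thesis by (simp add: P0_def)
qed

end

text \<open>The frontier of a convex set is negligible, so arbitrary values of \<open>u\<close> and
  \<open>w\<close> there do not affect the integral.\<close>

lemma elem_ip_cong:
  assumes K: "compact K" "convex K" and eq: "\<And>x. x \<in> interior K \<Longrightarrow> u x = c \<and> w x = d"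
  shows "elem_ip K u w = elem_ip K (\<lambda>_. c) (\<lambda>_. d)"
proof -
  let ?f = "\<lambda>x. u x * w x"
  have neg: "negligible (frontier K)" by (rule negligible_convex_frontier[OF K(2)])
  have eq': "?f x = c * d" if "x \<in> K - frontier K" for x
    using that eq[of x] closure_subset[of K] by (auto simp: frontier_def)
  have int: "(\<lambda>_. c * d) absolutely_integrable_on K"
    using K(1) by (intro absolutely_integrable_on_const lmeasurable_compact)
  moreover have "?f absolutely_integrable_on K \<longleftrightarrow> (\<lambda>_. c * d) absolutely_integrable_on K"
    by (rule absolutely_integrable_spike_eq[OF neg]) (simp add: eq')
  ultimately have "(LINT x:K|lebesgue. ?f x) = integral K ?f"
    "(LINT x:K|lebesgue. c * d) = integral K (\<lambda>_. c * d)"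
    using set_lebesgue_integral_eq_integral(2) by blast+
  moreover have "integral K ?f = integral K (\<lambda>_. c * d)"
    by (rule integral_spike[OF neg]) (simp add: eq')
  ultimately show ?thesis by (simp add: elem_ip_def)
qed

context
  fixes M :: plate_mesh
  assumes M: "plate_triangulation M"
begin

text \<open>By \<open>elem_push\<close> the approach runs through the interior of \<open>K\<close>,
  where \<open>u\<close> is the continuous \<open>g\<close>. Excluding the end points of
  \<open>E\<close> is what keeps the path in one element.\<close>

lemma trace_tendsto:
  fixes g :: "point \<Rightarrow> real"
  assumes K: "K \<in> elems M" "E edge_of K" and x: "x \<in> E" "\<not> x extreme_point_of E"
    and u: "\<And>y. y \<in> interior K \<Longrightarrow> u y = g y" and g: "continuous_on UNIV g"
  shows "Lim (at_right 0) (\<lambda>e. u (x - e *\<^sub>R outer_normal K E)) = g x"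
proof (rule tendsto_Lim)
  let ?n = "outer_normal K E"
  have "isCont g (x - 0 *\<^sub>R ?n)" using g by (simp add: continuous_on_eq_continuous_at)
  moreover have "((\<lambda>e. x - e *\<^sub>R ?n) \<longlongrightarrow> x - 0 *\<^sub>R ?n) (at_right 0)"
    by (intro tendsto_intros)
  ultimately have "((\<lambda>e. g (x - e *\<^sub>R ?n)) \<longlongrightarrow> g x) (at_right 0)"
    using isCont_tendsto_compose by fastforce
  moreover have "\<forall>\<^sub>F e in at_right 0. u (x - e *\<^sub>R ?n) = g (x - e *\<^sub>R ?n)"
    using elem_push[OF M K x] by eventually_elim (rule u)
  ultimately show "((\<lambda>e. u (x - e *\<^sub>R ?n)) \<longlongrightarrow> g x) (at_right 0)"
    by (simp add: tendsto_cong)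
qed simp

lemma trace_plus_eq:
  fixes g :: "point \<Rightarrow> real"
  assumes "K \<in> elems M" "E edge_of K" "x \<in> E" "\<not> x extreme_point_of E"
    "\<And>y. y \<in> interior K \<Longrightarrow> u y = g y" "continuous_on UNIV g" "outer_normal K E = n"
  shows "trace_plus n u x = g x"
  using trace_tendsto[OF assms(1-6)] by (simp add: trace_plus_def assms(7))

text \<open>Moving along \<open>n\<close> is moving against \<open>- n\<close>, the outer normal of
  the neighbour on the other side.\<close>

lemma trace_minus_eq:
  fixes g :: "point \<Rightarrow> real"
  assumes "K \<in> elems M" "E edge_of K" "x \<in> E" "\<not> x extreme_point_of E"
    "\<And>y. y \<in> interior K \<Longrightarrow> u y = g y" "continuous_on UNIV g" "outer_normal K E = - n"
  shows "trace_minus n u x = g x"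
  using trace_tendsto[OF assms(1-6)] by (simp add: trace_minus_def assms(7))

lemma edge_segment:
  assumes "K \<in> elems M" "E edge_of K"
  obtains a b where "E = closed_segment a b" "a \<noteq> b"
proof -
  obtain a b c where "tri K a b c" "E = closed_segment a b"
    using edge_tri elem_simplex[OF M] assms by metis
  with that tri_distinct show thesis by blast
qed

lemma avg_Tforce_morley:
  assumes E: "E \<in> edges M" and x: "x \<in> E" "\<not> x extreme_point_of E"
  shows "avg M E (Tforce lam mu n (morley M v)) x = 0"
proof -
  have T: "Tforce lam mu n (morley M v) y = 0" if K: "K \<in> elems M" and y: "y \<in> interior K" for K y
  proof -
    have "Tforce lam mu n (morley M v) y = Tforce lam mu n (morley_loc M K v) y"
      by (rule Tforce_cong_open[OF open_interior _ y]) (rule morley_interior[OF M K])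
    then show ?thesis by (simp add: Tforce_polys_2 morley_loc_polys_2[OF M K])
  qed
  show ?thesis
  proof (cases "E \<in> boundary_edges M")
    case True
    note K = boundary_elem[OF M True]
    have "trace_plus (enormal M E) (Tforce lam mu n (morley M v)) x = 0"
      using trace_plus_eq[OF K x T[OF K(1)]] boundary_edge_normal[OF M True K] by auto
    then show ?thesis using True by (simp add: avg_def)
  next
    case False
    obtain Kp Km where K: "Kp \<in> elems M" "Km \<in> elems M" "E edge_of Kp" "E edge_of Km" "Kp \<noteq> Km"
      "{K. K \<in> elems M \<and> E edge_of K} = {Kp, Km}" "outer_normal Kp E = enormal M E" "outer_normal Km E = - enormal M E"
      by (rule interior_edge_elems[OF M E False])
    have "trace_plus (enormal M E) (Tforce lam mu n (morley M v)) x = 0"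
      using trace_plus_eq[OF K(1,3) x T[OF K(1)]] K(7) by auto
    moreover have "trace_minus (enormal M E) (Tforce lam mu n (morley M v)) x = 0"
      using trace_minus_eq[OF K(2,4) x T[OF K(2)]] K(8) by auto
    ultimately show ?thesis using False by (simp add: avg_def)
  qed
qed

lemma edge_ip_Tforce_morley:
  assumes E: "E \<in> edges M"
  shows "edge_ip E (avg M E (Tforce lam mu n (morley M v))) w = 0"
    and "edge_ip E w (avg M E (Tforce lam mu n (morley M v))) = 0"
proof -
  obtain K where K: "K \<in> elems M" "E edge_of K" using E by (auto simp: edges_def)
  obtain a b where ab: "E = closed_segment a b" "a \<noteq> b" using edge_segment[OF K] .
  have 0: "edge_ip E (\<lambda>_. 0) (\<lambda>_. 0) = 0" by (simp add: edge_ip_def Let_def)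
  show "edge_ip E (avg M E (Tforce lam mu n (morley M v))) w = 0"
    by (rule trans[OF edge_ip_cong[OF ab] 0]) (simp add: avg_Tforce_morley[OF E])
  show "edge_ip E w (avg M E (Tforce lam mu n (morley M v))) = 0"
    by (rule trans[OF edge_ip_cong[OF ab] 0]) (simp add: avg_Tforce_morley[OF E])
qed

lemma interior_edge_jump_affine:
  assumes E: "E \<in> edges M" "E \<notin> boundary_edges M"
  shows "\<exists>f\<in>polys 1. f (edge_midpoint E) = 0 \<and>
    (\<forall>x\<in>E. \<not> x extreme_point_of E \<longrightarrow> jump M E (normal_deriv (enormal M E) (morley M v)) x = f x)"
proof -
  let ?n = "enormal M E"
  obtain Kp Km where K: "Kp \<in> elems M" "Km \<in> elems M" "E edge_of Kp" "E edge_of Km" "Kp \<noteq> Km"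
      "{K. K \<in> elems M \<and> E edge_of K} = {Kp, Km}" "outer_normal Kp E = ?n" "outer_normal Km E = - ?n"
    by (rule interior_edge_elems[OF M E])
  define d where "d = (\<lambda>K. normal_deriv ?n (morley_loc M K v))"
  have nd: "normal_deriv ?n (morley M v) y = d K y" if L: "K \<in> elems M" and y: "y \<in> interior K" for K y
    unfolding d_def
    by (rule normal_deriv_cong_open[OF open_interior _ y]) (rule morley_interior[OF M L])
  have d: "d K \<in> polys 1" if "K \<in> elems M" for K
    unfolding d_def by (rule normal_deriv_polys_1[OF morley_loc_polys_2[OF M that]])
  have cont: "continuous_on UNIV (d K)" if "K \<in> elems M" for K
    using d[OF that] polys_1_subset_2 polys_2_continuous by blast
  show ?thesis
  proof (intro bexI[of _ "\<lambda>x. d Kp x - d Km x"] conjI ballI impI)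
    show "(\<lambda>x. d Kp x - d Km x) \<in> polys 1"
      using d K by (intro polys_1_diff_closed) auto
    \<comment> \<open>Both local reconstructions prescribe the same averaged derivative along the
      same fixed normal of the edge.\<close>
    show "d Kp (edge_midpoint E) - d Km (edge_midpoint E) = 0"
      unfolding d_def using morley_loc_normal_deriv[OF M K(1,3)] morley_loc_normal_deriv[OF M K(2,4)] by simp
    fix x assume x: "x \<in> E" "\<not> x extreme_point_of E"
    have "trace_plus ?n (normal_deriv ?n (morley M v)) x = d Kp x"
      by (rule trace_plus_eq[OF K(1,3) x nd[OF K(1)] cont[OF K(1)] K(7)])
    moreover have "trace_minus ?n (normal_deriv ?n (morley M v)) x = d Km x"
      by (rule trace_minus_eq[OF K(2,4) x nd[OF K(2)] cont[OF K(2)] K(8)])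
    ultimately show "jump M E (normal_deriv ?n (morley M v)) x = d Kp x - d Km x"
      using E by (simp add: jump_def)
  qed
qed

lemma interior_edge_avg_Mnn:
  assumes E: "E \<in> edges M" "E \<notin> boundary_edges M"
  shows "\<exists>c. \<forall>x\<in>E. \<not> x extreme_point_of E \<longrightarrow>
     avg M E (Mnn lam mu (enormal M E) (morley M v)) x = c"
proof -
  let ?n = "enormal M E"
  obtain Kp Km where K: "Kp \<in> elems M" "Km \<in> elems M" "E edge_of Kp" "E edge_of Km" "Kp \<noteq> Km"
      "{K. K \<in> elems M \<and> E edge_of K} = {Kp, Km}" "outer_normal Kp E = ?n" "outer_normal Km E = - ?n"
    by (rule interior_edge_elems[OF M E])
  define m where "m = (\<lambda>K. \<Sum>i\<in>UNIV. \<Sum>j\<in>UNIV. stress_const lam mu (morley_loc M K v) i j * ?n $ i * ?n $ j)"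
  have nd: "Mnn lam mu ?n (morley M v) y = m K" if L: "K \<in> elems M" and y: "y \<in> interior K" for K y
  proof -
    have "Mnn lam mu ?n (morley M v) y = Mnn lam mu ?n (morley_loc M K v) y"
      by (rule Mnn_cong_open[OF open_interior _ y]) (rule morley_interior[OF M L])
    then show ?thesis by (simp add: Mnn_polys_2 morley_loc_polys_2[OF M L] m_def)
  qed
  show ?thesis
  proof (intro exI[of _ "(m Kp + m Km) / 2"] ballI impI)
    fix x assume x: "x \<in> E" "\<not> x extreme_point_of E"
    have "trace_plus ?n (Mnn lam mu ?n (morley M v)) x = m Kp"
      by (rule trace_plus_eq[OF K(1,3) x nd[OF K(1)] _ K(7)]) auto
    moreover have "trace_minus ?n (Mnn lam mu ?n (morley M v)) x = m Km"
      by (rule trace_minus_eq[OF K(2,4) x nd[OF K(2)] _ K(8)]) auto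
    ultimately show "avg M E (Mnn lam mu ?n (morley M v)) x = (m Kp + m Km) / 2"
      using E by (simp add: avg_def)
  qed
qed

text \<open>Every term sees the jump only through its mean: the moments multiply it by a constant,
  and the penalty projects it by \<open>P0\<close>.\<close>

lemma aE_interior_edge:
  assumes E: "E \<in> edges M" "E \<notin> boundary_edges M"
  shows "aE M lam mu beta E (morley M U) (morley M v) = 0"
proof -
  let ?n = "enormal M E"
  let ?J = "\<lambda>v. jump M E (normal_deriv ?n (morley M v))" and ?A = "\<lambda>v. avg M E (Mnn lam mu ?n (morley M v))"
  obtain K where K: "K \<in> elems M" "E edge_of K" using E(1) by (auto simp: edges_def)
  obtain a b where ab: "E = closed_segment a b" "a \<noteq> b" using edge_segment[OF K] .
  have P: "P0 E (?J v) = (\<lambda>_. 0)" for v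
  proof -
    obtain f where f: "f \<in> polys 1" "f (edge_midpoint E) = 0"
      "\<forall>x\<in>E. \<not> x extreme_point_of E \<longrightarrow> ?J v x = f x"
      using interior_edge_jump_affine[OF E, of v] by (elim bexE conjE)
    show ?thesis by (rule P0_eq_0[OF ab f(1,2)]) (simp add: f(3))
  qed
  have AJ: "edge_ip E (?A u) (?J v) = 0" "edge_ip E (?J v) (?A u) = 0" for u v
  proof -
    obtain f where f: "f \<in> polys 1" "f (edge_midpoint E) = 0"
      "\<forall>x\<in>E. \<not> x extreme_point_of E \<longrightarrow> ?J v x = f x"
      using interior_edge_jump_affine[OF E, of v] by (elim bexE conjE)
    obtain c where c: "\<forall>x\<in>E. \<not> x extreme_point_of E \<longrightarrow> ?A u x = c"
      using interior_edge_avg_Mnn[OF E, of lam mu u] by (elim exE)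
    have 0: "edge_ip E (\<lambda>_. c) f = 0"
      using edge_ip_const_affine[OF ab f(1), of c] f(2) by simp
    show "edge_ip E (?A u) (?J v) = 0" "edge_ip E (?J v) (?A u) = 0"
      by (rule trans[OF edge_ip_cong[OF ab] 0], simp add: f(3) c)+
  qed
  show ?thesis
    unfolding aE_def Let_def AJ P by (simp add: edge_ip_def Let_def)
qed

section \<open>Assembly of the global form\<close>

lemma finite_edges: "finite (edges M)"
proof -
  have "finite {E. E edge_of K}" if K: "K \<in> elems M" for K
  proof -
    obtain a b c where "tri K a b c" using simplex_2_tri elem_simplex[OF M K] by metis
    from tri_edge[OF this] show ?thesis by simp
  qed
  moreover have "edges M = (\<Union>K\<in>elems M. {E. E edge_of K})" by (auto simp: edges_def)
  ultimately show ?thesis using finite_elems[OF M] by simp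
qed

lemma boundary_edge_infinite:
  assumes "E \<in> boundary_edges M"
  shows "infinite E"
proof -
  obtain a b where "E = closed_segment a b" "a \<noteq> b"
    using edge_segment boundary_elem[OF M assms] by metis
  then show ?thesis by (simp add: finite_closed_segment)
qed

text \<open>The boundary parts meet in finitely many points, while an edge is a nondegenerate
  segment. Hence no clamped edge is lost when the other two parts are removed from the sum.\<close>

lemma EC_disjoint: "E \<in> EC M \<Longrightarrow> E \<notin> ES M \<union> EF M"
proof
  assume C: "E \<in> EC M" and "E \<in> ES M \<union> EF M"
  then have "E \<subseteq> GammaC M \<inter> GammaS M \<or> E \<subseteq> GammaC M \<inter> GammaF M"
    by (auto simp: EC_def ES_def EF_def)
  moreover have "finite (GammaC M \<inter> GammaS M)" "finite (GammaC M \<inter> GammaF M)"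
    using M by (simp_all add: plate_triangulation_def)
  ultimately have "finite E" using finite_subset by blast
  with C boundary_edge_infinite show False by (simp add: EC_def)
qed

text \<open>On the boundary of \<open>K\<close> the global function may follow another element, but
  the integrals depend only on the interior.\<close>

lemma aK_morley:
  assumes K: "K \<in> elems M"
  shows "aK lam mu K (morley M U) (morley M v) = aK lam mu K (morley_loc M K U) (morley_loc M K v)"
proof -
  note simplex = elem_simplex[OF M K]
  have S: "stress lam mu (morley M U) i j x = stress_const lam mu (morley_loc M K U) i j"
    if x: "x \<in> interior K" for i j x
  proof -
    have "stress lam mu (morley M U) i j x = stress lam mu (morley_loc M K U) i j x"
      by (rule stress_cong_open[OF open_interior _ x]) (rule morley_interior[OF M K])
    then show ?thesis by (simp add: stress_polys_2 morley_loc_polys_2[OF M K])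
  qed
  have C: "curvature (morley M v) i j x = hess (morley_loc M K v) i j" if x: "x \<in> interior K" for i j x
  proof -
    have "curvature (morley M v) i j x = curvature (morley_loc M K v) i j x"
      unfolding curvature_def
      by (rule pd_pd_cong_open[OF open_interior _ x]) (rule morley_interior[OF M K])
    then show ?thesis by (simp add: curvature_polys_2 morley_loc_polys_2[OF M K])
  qed
  have "elem_ip K (stress lam mu (morley M U) i j) (curvature (morley M v) i j) =
      elem_ip K (stress lam mu (morley_loc M K U) i j) (curvature (morley_loc M K v) i j)" for i j
    unfolding stress_polys_2[OF morley_loc_polys_2[OF M K]] curvature_polys_2[OF morley_loc_polys_2[OF M K]]
    by (rule elem_ip_cong[OF compact_simplex[OF simplex] convex_simplex[OF simplex]]) (simp_all add: S C)
  then show ?thesis by (simp add: aK_def)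
qed

lemma aform_morley:
  "aform M lam mu beta (morley M U) (morley M v) =
     (\<Sum>K\<in>elems M. aK lam mu K (morley_loc M K U) (morley_loc M K v))
     + (\<Sum>E\<in>EC M. aE M lam mu beta E (morley M U) (morley M v))"
proof -
  have B: "boundary_edges M = EC M \<union> ES M \<union> EF M"
    using M by (simp add: plate_triangulation_def)
  have sub: "boundary_edges M \<subseteq> edges M"
    by (auto simp: boundary_edges_def edges_def)
  have "(\<Sum>E\<in>edges M - (ES M \<union> EF M). aE M lam mu beta E (morley M U) (morley M v)) =
        (\<Sum>E\<in>EC M. aE M lam mu beta E (morley M U) (morley M v))"
  proof (rule sum.mono_neutral_right)
    show "EC M \<subseteq> edges M - (ES M \<union> EF M)"
      using EC_disjoint B sub by blast
    \<comment> \<open>The three parts exhaust the boundary edges, so what remains is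
      interior.\<close>
    show "\<forall>E\<in>edges M - (ES M \<union> EF M) - EC M. aE M lam mu beta E (morley M U) (morley M v) = 0"
      using B aE_interior_edge by blast
  qed (simp add: finite_edges)
  moreover have "(\<Sum>E\<in>edges M - EF M.
      edge_ip E (avg M E (Tforce lam mu (enormal M E) (morley M U))) (jump M E (morley M v))
      + edge_ip E (jump M E (morley M U)) (avg M E (Tforce lam mu (enormal M E) (morley M v)))) = 0"
    by (rule sum.neutral) (simp add: edge_ip_Tforce_morley)
  ultimately show ?thesis
    unfolding aform_def by (simp add: aK_morley)
qed

end

section \<open>Equivalence with the Basic Plate Triangle\<close>

theorem mainTheorem4:
  fixes M :: plate_mesh and lam mu beta :: real
  assumes "plate_triangulation M" and "mu > 0" and "beta > 0"
  shows "morley M \<in> CP1 M \<rightarrow> DPV M \<and>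
    (\<forall>U\<in>CP1 M. \<forall>v\<in>CP1 M. \<forall>K\<in>elems M.
       aK lam mu K (morley_loc M K U) (morley_loc M K v) = bpt_form M lam mu K U v) \<and>
    (\<forall>U\<in>CP1 M. \<forall>v\<in>CP1 M.
       aform M lam mu beta (morley M U) (morley M v) =
         (\<Sum>K\<in>elems M. bpt_form M lam mu K U v)
         + (\<Sum>E\<in>EC M. aE M lam mu beta E (morley M U) (morley M v)))"
  using morley_DPV[OF assms(1)] aK_morley_loc[OF assms(1)] aform_morley[OF assms(1)]
  by auto

end
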